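(* Let $n\ge k\ge 1$ and let $f\in\mathbb{F}_q[x]$ be monic of degree $d\le k$, with factorization $f=f_1^{e_1}\cdots f_t^{e_t}$ into distinct monic irreducibles $f_i$ of degree $d_i$. Then $$\left|\Phi_{n,k}^{-1}(f)\right|={k\brack d}_q\,\frac{q^{d^2-d}F(q,d)}{\prod_{i=1}^{t}F(q^{d_i},e_i)}\prod_{i=d+1}^{k}(q^n-q^i).$$
   Context: $\mathbb{F}_q$ is the finite field with $q$ elements. $I_{n,k}\in M_{n,k}(\mathbb{F}_q)$ has $(i,j)$ entry $1$ if $i=j$ and $0$ otherwise. For a polynomial matrix $M\in M_{n,k}(\mathbb{F}_q[x])$, $\delta_k(M)$ denotes its $k$-th determinantal divisor, the monic gcd of all its $k\times k$ minors. The map $\Phi_{n,k}:M_{n,k}(\mathbb{F}_q)\to\mathbb{F}_q[x]$ is $\Phi_{n,k}(A)=\delta_k(xI_{n,k}-A)$ (for $n=k$ this is the characteristic polynomial). For a nonnegative integer $r$, $F(q,r)=\prod_{i=1}^{r}(1-q^{-i})$ (so $F(q,0)=1$). ${k\brack d}_q=\prod_{i=0}^{d-1}\frac{q^{k-i}-1}{q^{i+1}-1}$ is the $q$-binomial coefficient. Empty products equal $1$. *)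

theory Defs
  imports "Jordan_Normal_Form.Determinant" "Jordan_Normal_Form.DL_Submatrix"
          "HOL-Computational_Algebra.Polynomial_Factorial" "HOL-Computational_Algebra.Field_as_Ring"
begin

definition minors :: "nat \<Rightarrow> 'a::comm_ring_1 mat \<Rightarrow> 'a set" where
  "minors k M = {det (submatrix M I J) | I J.
      I \<subseteq> {0..<dim_row M} \<and> J \<subseteq> {0..<dim_col M} \<and> card I = k \<and> card J = k}"

definition det_divisor :: "nat \<Rightarrow> 'a::field_gcd poly mat \<Rightarrow> 'a poly" where
  "det_divisor k M = Gcd (minors k M)"

definition xI_minus :: "nat \<Rightarrow> nat \<Rightarrow> 'a::field mat \<Rightarrow> 'a poly mat" where
  "xI_minus n k A = mat n k (\<lambda>(i,j). (if i = j then [:0, 1:] else 0) - [:A $$ (i,j):])"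

definition Phi :: "nat \<Rightarrow> nat \<Rightarrow> 'a::field_gcd mat \<Rightarrow> 'a poly" where
  "Phi n k A = det_divisor k (xI_minus n k A)"

definition F_fun :: "real \<Rightarrow> nat \<Rightarrow> real" where
  "F_fun q r = (\<Prod>i=1..r. 1 - q powi (- int i))"

definition qbinom :: "real \<Rightarrow> nat \<Rightarrow> nat \<Rightarrow> real" where
  "qbinom q k d = (\<Prod>i<d. (q ^ (k - i) - 1) / (q ^ (i + 1) - 1))"

end

theory Submission
  imports Defs "Jordan_Normal_Form.Char_Poly"
begin

text \<open>
  For \<open>n > k\<close> look at the last row \<open>y\<close> of \<open>A\<close>. If \<open>y = 0\<close>, it can be deleted. Otherwise a change of
  basis turns \<open>y\<close> into the last unit vector; eliminating with it removes a row and a column of the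
  pencil and leaves the pencil of an arbitrary \<open>(n - 1) \<times> (k - 1)\<close> matrix. The resulting recursion
  reduces the claim to counting the square matrices with characteristic polynomial \<open>f\<close>.

  For these, follow the Krylov sequence of a nonzero vector: if it spans a subspace of dimension
  \<open>m\<close>, the matrix is block triangular with a companion block for some monic divisor \<open>h\<close> of \<open>f\<close> of
  degree \<open>m\<close> and a second block with characteristic polynomial \<open>f / h\<close>. Dividing the counts by the
  order of the general linear group turns this into \<open>q ^ deg f * c f = (\<Sum>g dvd f. c g)\<close>, which
  determines \<open>c\<close> and is solved by the multiplicative function with \<open>c (p ^ e) = 1 / (Q ^ e * F(Q, e))\<close>,
  where \<open>Q = q ^ deg p\<close>.
\<close>

subsection \<open>Determinantal divisors\<close>

lemma pick_atLeast0LessThan: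
  assumes "j < k"
  shows "pick {0..<k} j = j"
proof -
  have "{a \<in> {0..<k}. a < j} = {0..<j}" using assms by auto
  then show ?thesis using pick_card_in_set[of j "{0..<k}"] assms by simp
qed

text \<open>The map \<open>f\<close> may repeat rows or list them in any order. A repetition makes
  the determinant vanish; an injective choice gives a \<open>k\<close>-minor with its rows permuted,
  so the two determinants agree up to sign.\<close>

lemma det_selected_rows_dvd:
  fixes M :: "'a::comm_ring_1 mat"
  assumes M: "M \<in> carrier_mat n k" and f: "\<And>i. i < k \<Longrightarrow> f i < n"
    and d: "\<And>x. x \<in> minors k M \<Longrightarrow> d dvd x"
  shows "d dvd det (mat\<^sub>r k k (\<lambda>i. row M (f i)))"
proof (cases "inj_on f {0..<k}")
  case False
  then obtain i j where ij: "f i = f j" "i \<noteq> j" "i < k" "j < k"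
    unfolding inj_on_def by auto
  let ?B = "mat\<^sub>r k k (\<lambda>i. row M (f i))"
  have "row ?B i = row ?B j" using ij M by auto
  then have "det ?B = 0"
    using det_identical_rows[of ?B k i j] ij by (auto intro: mat_row_carrierI)
  then show ?thesis by simp
next
  case True
  define I where "I = f ` {0..<k}"
  have finI: "finite I" unfolding I_def by simp
  have cardI: "card I = k" unfolding I_def using True by (simp add: card_image)
  have I: "I \<subseteq> {0..<n}" unfolding I_def using f by auto
  \<comment> \<open>\<open>p i\<close> is the rank of \<open>f i\<close> among the selected rows, so
    \<open>p\<close> sorts the selection; it is the identity from \<open>k\<close> on, as
    \<open>permutes\<close> demands.\<close>
  define p where "p i = (if i < k then card {a\<in>I. a < f i} else i)" for i
  have pick: "pick I (p i) = f i" if "i < k" for i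
    using that pick_card_in_set[of "f i" I] unfolding p_def I_def by auto
  have p_lt: "p i < k" if "i < k" for i
  proof -
    have "{a\<in>I. a < f i} \<subset> I" using that unfolding I_def by auto
    then have "card {a\<in>I. a < f i} < card I" by (rule psubset_card_mono[OF finI])
    then show ?thesis using that cardI unfolding p_def by simp
  qed
  have "inj_on p {0..<k}"
    by (rule inj_onI) (metis True atLeastLessThan_iff inj_on_def pick)
  then have p: "p permutes {0..<k}"
    by (rule inj_on_nat_permutes) (auto simp: p_lt, auto simp: p_def)
  let ?S = "submatrix M I {0..<k}"
  have rows: "{i. i < n \<and> i \<in> I} = I" using I M by auto
  have cols: "{j. j < k} = {0..<k}" using M by auto
  have S: "?S \<in> carrier_mat k k"
    unfolding carrier_mat_def by (simp add: dim_submatrix carrier_matD[OF M] rows cols cardI)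
  have entry: "?S $$ (p i, j) = M $$ (f i, j)" if "i < k" "j < k" for i j
    using that p_lt[OF that(1)] by (subst submatrix_index) (simp_all add: carrier_matD[OF M] rows cols cardI pick pick_atLeast0LessThan)
  have "mat\<^sub>r k k (\<lambda>i. row M (f i)) = mat k k (\<lambda>(i,j). ?S $$ (p i, j))"
    by (rule eq_matI) (use M f in \<open>auto simp: entry\<close>)
  then have "det (mat\<^sub>r k k (\<lambda>i. row M (f i))) = signof p * det ?S"
    using det_permute_rows[OF S p] by simp
  moreover have "det ?S \<in> minors k M"
    unfolding minors_def using I M cardI
    by (intro CollectI exI[of _ I] exI[of _ "{0..<k}"]) auto
  ultimately show ?thesis using d by simp
qed

text \<open>This is the useful half of Cauchy-Binet: each row of \<open>U * M\<close> is a
  combination of rows of \<open>M\<close>, and multilinearity writes the determinant as a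
  combination of determinants of selected rows. For divisibility there is no need to collect equal
  minors.\<close>

lemma det_mult_dvd_of_minors_dvd:
  fixes M :: "'a::comm_ring_1 mat"
  assumes M: "M \<in> carrier_mat n k" and U: "U \<in> carrier_mat k n"
    and d: "\<And>x. x \<in> minors k M \<Longrightarrow> d dvd x"
  shows "d dvd det (U * M)"
proof -
  have "det (U * M) = (\<Sum>f\<in>{f. (\<forall>i\<in>{0..<k}. f i \<in> {0..<n}) \<and> (\<forall>i. i \<notin> {0..<k} \<longrightarrow> f i = i)}.
      det (mat\<^sub>r k k (\<lambda>i. U $$ (i, f i) \<cdot>\<^sub>v row M (f i))))"
    unfolding mat_mul_finsum_alt[OF U M]
    by (rule det_linear_rows_sum) (use M U in auto)
  moreover have "d dvd det (mat\<^sub>r k k (\<lambda>i. U $$ (i, f i) \<cdot>\<^sub>v row M (f i)))"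
    if "\<forall>i\<in>{0..<k}. f i \<in> {0..<n}" for f
  proof -
    have "det (mat\<^sub>r k k (\<lambda>i. U $$ (i, f i) \<cdot>\<^sub>v row M (f i)))
        = prod (\<lambda>i. U $$ (i, f i)) {0..<k} * det (mat\<^sub>r k k (\<lambda>i. row M (f i)))"
      by (rule det_rows_mul) (use M in auto)
    then show ?thesis using det_selected_rows_dvd[OF M _ d] that by simp
  qed
  ultimately show ?thesis by (auto intro!: dvd_sum)
qed

text \<open>\<open>M\<close> has exactly \<open>k\<close> columns, so a \<open>k\<close>-minor uses
  all of them, and a 0/1 matrix \<open>U\<close> picks out its rows.\<close>

lemma minor_eq_det_mult:
  fixes M :: "'a::comm_ring_1 mat"
  assumes M: "M \<in> carrier_mat n k" and x: "x \<in> minors k M"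
  shows "\<exists>U\<in>carrier_mat k n. x = det (U * M)"
proof -
  obtain I J where I: "I \<subseteq> {0..<n}" "card I = k" and J: "J \<subseteq> {0..<k}" "card J = k"
    and xd: "x = det (submatrix M I J)"
    using x M unfolding minors_def by auto
  have Jk: "J = {0..<k}" using J by (metis card_atLeastLessThan card_subset_eq diff_zero finite_atLeastLessThan)
  define U :: "'a mat" where "U = mat k n (\<lambda>(i,j). if j = pick I i then 1 else 0)"
  have rows: "{i. i < n \<and> i \<in> I} = I" using I M by auto
  have cols: "{j. j < k} = {0..<k}" using M by auto
  have pn: "pick I i < n" if "i < k" for i
    using pick_in_set_le[of i I] I that by auto
  have "submatrix M I J = U * M"
  proof (rule eq_matI)
    fix i j assume "i < dim_row (U * M)" "j < dim_col (U * M)"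
    then have ij: "i < k" "j < k" using M by (auto simp: U_def)
    have "(U * M) $$ (i,j) = (\<Sum>l = 0..<n. (if l = pick I i then 1 else 0) * M $$ (l,j))"
      using ij M by (simp add: U_def scalar_prod_def)
    also have "\<dots> = (\<Sum>l = 0..<n. if l = pick I i then M $$ (l,j) else 0)"
      by (rule sum.cong) auto
    also have "\<dots> = M $$ (pick I i, j)" using pn[OF ij(1)] by simp
    finally show "submatrix M I J $$ (i,j) = (U * M) $$ (i,j)"
      unfolding Jk using ij by (subst submatrix_index) (simp_all add: carrier_matD[OF M] rows cols I pick_atLeast0LessThan)
  qed (use M in \<open>simp_all add: dim_submatrix carrier_matD[OF M] rows U_def Jk I\<close>)
  then show ?thesis using xd by (intro bexI[of _ U]) (auto simp: U_def)
qed

text \<open>Replacing the minors by all determinants \<open>det (U * M)\<close> makes the invariance of the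
  determinantal divisor under invertible transformations immediate.\<close>

lemma minors_dvd_iff:
  fixes M :: "'a::comm_ring_1 mat"
  assumes M: "M \<in> carrier_mat n k"
  shows "(\<forall>x\<in>minors k M. d dvd x) \<longleftrightarrow> (\<forall>U\<in>carrier_mat k n. d dvd det (U * M))"
  using det_mult_dvd_of_minors_dvd[OF M] minor_eq_det_mult[OF M] by metis

text \<open>A gcd is determined up to a unit by its divisors, and \<open>Gcd\<close> is normalized.
  The two matrices may differ in size, so that the criterion also serves when rows and columns are
  removed.\<close>

lemma det_divisor_eqI:
  fixes M M' :: "'a::field_gcd poly mat"
  assumes M: "M \<in> carrier_mat n k" and M': "M' \<in> carrier_mat n' k'"
    and eq: "\<And>d. (\<forall>U\<in>carrier_mat k n. d dvd det (U * M)) \<longleftrightarrow>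
      (\<forall>U\<in>carrier_mat k' n'. d dvd det (U * M'))"
  shows "det_divisor k M = det_divisor k' M'"
proof -
  have "(\<forall>x\<in>minors k M. d dvd x) \<longleftrightarrow> (\<forall>x\<in>minors k' M'. d dvd x)" for d
    using eq minors_dvd_iff[OF M] minors_dvd_iff[OF M'] by simp
  then have "d dvd Gcd (minors k M) \<longleftrightarrow> d dvd Gcd (minors k' M')" for d
    by (simp add: dvd_Gcd_iff)
  then show ?thesis unfolding det_divisor_def
    by (meson associated_eqI dvd_refl normalize_Gcd)
qed

lemma Phi_0: "Phi n 0 A = 1"
proof -
  \<comment> \<open>Without columns every product \<open>U * M\<close> is the empty square matrix,
    whatever the number of rows, so the comparison with \<open>1\<^sub>m 0\<close> is free.\<close>
  have "det_divisor 0 (xI_minus n 0 A) = det_divisor 0 (1\<^sub>m 0)"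
    by (rule det_divisor_eqI[of _ n _ _ 0]) (auto simp: xI_minus_def)
  also have "det (submatrix (1\<^sub>m 0) {} {}) = (1::'a poly)"
    by (rule det_dim_zero) (auto simp: submatrix_def)
  then have "minors 0 (1\<^sub>m 0 :: 'a poly mat) = {1}"
    unfolding minors_def by auto
  then have "det_divisor 0 (1\<^sub>m 0) = (1::'a poly)" unfolding det_divisor_def by simp
  finally show ?thesis unfolding Phi_def .
qed

text \<open>Take the permutation matrix of the transposition of \<open>m\<close> and
  \<open>s\<close> and overwrite column \<open>m\<close> with \<open>w\<close>. The overwritten
  column had its 1 in row \<open>s\<close>, so \<open>w $ s \<noteq> 0\<close> keeps the matrix
  invertible. All columns other than \<open>m\<close> and \<open>s\<close> stay unit vectors, which
  lets a base change fix the vectors chosen earlier.\<close>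

lemma invertible_mat_with_column:
  fixes w :: "'a::field vec"
  assumes m: "m < k" and s: "s < k" and w: "w \<in> carrier_vec k" and ws: "w $ s \<noteq> 0"
  obtains P Q where "P \<in> carrier_mat k k" "Q \<in> carrier_mat k k" "P * Q = 1\<^sub>m k" "Q * P = 1\<^sub>m k"
    "col P m = w" "\<And>i. i < k \<Longrightarrow> i \<noteq> m \<Longrightarrow> i \<noteq> s \<Longrightarrow> col P i = unit_vec k i"
proof -
  define \<tau> where "\<tau> = (\<lambda>r. if r = m then s else if r = s then m else r)"
  define P where "P = mat k k (\<lambda>(r,c). if c = m then w $ r else if c = \<tau> r then 1 else 0)"
  have P: "P \<in> carrier_mat k k" unfolding P_def by simp
  have "det P \<noteq> 0"
  proof
    assume "det P = 0"
    then obtain v where v: "v \<in> carrier_vec k" "v \<noteq> 0\<^sub>v k" "P *\<^sub>v v = 0\<^sub>v k"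
      using det_0_iff_vec_prod_zero_field[OF P] by auto
    have eq: "w $ r * v $ m + (if \<tau> r = m then 0 else v $ \<tau> r) = 0" if r: "r < k" for r
    proof -
      have "0 = (P *\<^sub>v v) $ r" using v r by simp
      also have "\<dots> = (\<Sum>c = 0..<k. (if c = m then w $ r else if c = \<tau> r then 1 else 0) * v $ c)"
        using v(1) r by (simp add: P_def scalar_prod_def)
      also have "\<dots> = (\<Sum>c = 0..<k. (if c = m then w $ r * v $ c else 0) +
          (if c = \<tau> r then (if \<tau> r = m then 0 else v $ c) else 0))"
        by (rule sum.cong) auto
      also have "\<dots> = w $ r * v $ m + (if \<tau> r = m then 0 else v $ \<tau> r)"
        using m s r by (simp add: sum.distrib \<tau>_def)
      finally show ?thesis by simp
    qed
    \<comment> \<open>In row \<open>s\<close> the second summand is absent because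
      \<open>\<tau> s = m\<close>, so this row isolates \<open>v $ m\<close>; the remaining rows
      then give the other entries one at a time.\<close>
    have vm: "v $ m = 0" using eq[OF s] ws by (simp add: \<tau>_def split: if_splits)
    have "v $ r = 0" if "r < k" for r
    proof (cases "r = m")
      case False
      have "\<tau> r < k" "\<tau> (\<tau> r) = r" using that m s by (auto simp: \<tau>_def)
      then show ?thesis using eq[of "\<tau> r"] vm False by simp
    qed (use vm in simp)
    then have "v = 0\<^sub>v k" using v by (intro eq_vecI) auto
    then show False using v by simp
  qed
  from det_non_zero_imp_unit[OF P this, of "()"]
  obtain Q where Q: "Q \<in> carrier_mat k k" "P * Q = 1\<^sub>m k" "Q * P = 1\<^sub>m k"
    unfolding Units_def ring_mat_def by auto
  show ?thesis
    by (rule that[OF P Q])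
      (use w m in \<open>auto simp: P_def \<tau>_def intro!: eq_vecI\<close>)
qed

subsection \<open>The map Phi under constant transformations\<close>

lemma normalize_monic_poly:
  fixes p :: "'a::field_gcd poly"
  assumes "lead_coeff p = 1"
  shows "normalize p = p"
  using assms by (simp add: normalize_poly_eq_map_poly)

text \<open>Multiplying by \<open>D\<close> on the left only permutes the test matrices
  \<open>U\<close>, and multiplying by \<open>P\<close> on the right scales every test determinant
  by the unit \<open>det P\<close>.\<close>

lemma det_divisor_mult_invertible:
  fixes M :: "'a::field_gcd poly mat"
  assumes M: "M \<in> carrier_mat n k"
    and D: "D \<in> carrier_mat n n" and E: "E \<in> carrier_mat n n" and ED: "E * D = 1\<^sub>m n"
    and P: "P \<in> carrier_mat k k" and Q: "Q \<in> carrier_mat k k" and PQ: "P * Q = 1\<^sub>m k"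
  shows "det_divisor k (D * M * P) = det_divisor k M"
proof (rule det_divisor_eqI[of _ n _ _ n])
  have det1: "det P * det Q = 1" using det_mult[OF P Q] PQ by simp
  have step: "det (U * (D * M * P)) = det (U * D * M) * det P" if U: "U \<in> carrier_mat k n" for U
  proof -
    have "U * (D * M * P) = U * D * M * P"
      using U D M P by (simp add: assoc_mult_mat[of _ k n _ n _ k] assoc_mult_mat[of _ k n _ k _ k])
    moreover have "U * D * M \<in> carrier_mat k k" using U D M by simp
    ultimately show ?thesis using P by (simp add: det_mult)
  qed
  fix d
  show "(\<forall>U\<in>carrier_mat k n. d dvd det (U * (D * M * P))) \<longleftrightarrow>
    (\<forall>U\<in>carrier_mat k n. d dvd det (U * M))"
  proof safe
    fix U :: "'a poly mat"
    assume a: "\<forall>U\<in>carrier_mat k n. d dvd det (U * (D * M * P))" and U: "U \<in> carrier_mat k n"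
    have "U * E * D = U"
      using U D E ED by (simp add: assoc_mult_mat[of _ k n _ n _ n])
    then have "det (U * E * (D * M * P)) = det (U * M) * det P"
      using step[of "U * E"] U E by simp
    then have "d dvd det (U * M) * det P" using a U E by (metis mult_carrier_mat)
    then have "d dvd det (U * M) * (det P * det Q)"
      by (metis dvd_mult2 mult.assoc)
    then show "d dvd det (U * M)" using det1 by simp
  next
    fix U :: "'a poly mat"
    assume a: "\<forall>U\<in>carrier_mat k n. d dvd det (U * M)" and U: "U \<in> carrier_mat k n"
    then show "d dvd det (U * (D * M * P))"
      using step[OF U] D by simp
  qed
qed (use M D P in auto)

text \<open>Every test determinant is a multiple of the characteristic polynomial, and
  \<open>U = 1\<^sub>m k\<close> attains it. Being monic, it is already normalized.\<close>

lemma Phi_square: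
  fixes A :: "'a::field_gcd mat"
  assumes A: "A \<in> carrier_mat k k"
  shows "Phi k k A = char_poly A"
proof -
  have M: "xI_minus k k A = char_poly_matrix A"
    unfolding xI_minus_def char_poly_matrix_def using A by (intro eq_matI) auto
  have C: "char_poly_matrix A \<in> carrier_mat k k" using A by simp
  have "(\<forall>U\<in>carrier_mat k k. d dvd det (U * char_poly_matrix A)) \<longleftrightarrow> d dvd char_poly A" for d
  proof -
    have "d dvd det (1\<^sub>m k * char_poly_matrix A) \<longleftrightarrow> d dvd char_poly A"
      using C by (simp add: char_poly_def)
    then show ?thesis using det_mult[OF _ C] C unfolding char_poly_def
      by (metis dvd_mult one_carrier_mat)
  qed
  then have "d dvd Gcd (minors k (char_poly_matrix A)) \<longleftrightarrow> d dvd char_poly A" for d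
    using minors_dvd_iff[OF C] by (simp add: dvd_Gcd_iff)
  moreover have "normalize (char_poly A) = char_poly A"
    using degree_monic_char_poly[OF A] by (intro normalize_monic_poly) simp
  ultimately have "Gcd (minors k (char_poly_matrix A)) = char_poly A"
    by (metis associated_eqI dvd_refl normalize_Gcd)
  then show ?thesis unfolding Phi_def det_divisor_def M .
qed

text \<open>Since \<open>k \<le> n\<close>, row \<open>n\<close> of the pencil contains no
  \<open>x\<close>; it vanishes, and the last column of \<open>U\<close> is irrelevant.\<close>

lemma Phi_append_zero_row:
  fixes A :: "'a::field_gcd mat"
  assumes A: "A \<in> carrier_mat n k" and kn: "k \<le> n"
  shows "Phi (Suc n) k (mat (Suc n) k (\<lambda>(i,j). if i < n then A $$ (i,j) else 0)) = Phi n k A"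
    (is "Phi _ _ ?B = _")
  unfolding Phi_def
proof (rule det_divisor_eqI[of _ "Suc n" _ _ n])
  let ?M = "xI_minus n k A" and ?N = "xI_minus (Suc n) k ?B"
  fix d :: "'a poly"
  have eq: "U * ?N = mat k n (\<lambda>(i,j). U $$ (i,j)) * ?M" if U: "U \<in> carrier_mat k (Suc n)" for U
    by (rule eq_matI) (use U kn in \<open>auto simp: xI_minus_def scalar_prod_def intro!: sum.cong\<close>)
  show "(\<forall>U\<in>carrier_mat k (Suc n). d dvd det (U * ?N)) \<longleftrightarrow> (\<forall>U\<in>carrier_mat k n. d dvd det (U * ?M))"
  proof safe
    fix U :: "'a poly mat"
    assume a: "\<forall>U\<in>carrier_mat k (Suc n). d dvd det (U * ?N)" and U: "U \<in> carrier_mat k n"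
    define V where "V = mat k (Suc n) (\<lambda>(i,j). if j < n then U $$ (i,j) else 0)"
    have V: "V \<in> carrier_mat k (Suc n)" unfolding V_def by simp
    have "mat k n (\<lambda>(i,j). V $$ (i,j)) = U" by (rule eq_matI) (use U in \<open>auto simp: V_def\<close>)
    then show "d dvd det (U * ?M)" using a V eq[OF V] by auto
  qed (auto simp: eq)
qed (auto simp: xI_minus_def)

text \<open>As \<open>k < n\<close>, the last row of the pencil is \<open>(0, ..., 0, -1)\<close>.
  It clears the rest of the last column, including the \<open>x\<close> in row \<open>k\<close>, and
  what remains in the upper left corner is the pencil of \<open>A\<close>; the entries of
  \<open>b\<close> drop out entirely.\<close>

lemma Phi_append_unit_row:
  fixes A :: "'a::field_gcd mat"
  assumes A: "A \<in> carrier_mat n k" and b: "b \<in> carrier_mat n 1" and kn: "k < n"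
  shows "Phi (Suc n) (Suc k) (four_block_mat A b (0\<^sub>m 1 k) (1\<^sub>m 1)) = Phi n k A"
proof -
  define M where "M = xI_minus n k A"
  define c where "c = mat n 1 (\<lambda>(i,j). (if i = k then [:0,1:] else 0) - [:b $$ (i,0):])"
  define N where "N = four_block_mat M (0\<^sub>m n 1) (0\<^sub>m 1 k) (- 1\<^sub>m 1)"
  have M: "M \<in> carrier_mat n k" unfolding M_def xI_minus_def by simp
  have c: "c \<in> carrier_mat n 1" unfolding c_def by simp
  have N: "N \<in> carrier_mat (Suc n) (Suc k)" unfolding N_def using M by auto
  let ?F = "four_block_mat M c (0\<^sub>m 1 k) (- 1\<^sub>m 1)"
  have F: "xI_minus (Suc n) (Suc k) (four_block_mat A b (0\<^sub>m 1 k) (1\<^sub>m 1)) = ?F"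
    by (rule eq_matI) (use A b kn in \<open>auto simp: xI_minus_def M_def c_def less_Suc_eq one_pCons\<close>)
  have Fc: "?F \<in> carrier_mat (Suc n) (Suc k)" using M by auto
  \<comment> \<open>\<open>?D\<close> adds \<open>c\<close> times the last row, whose only nonzero
    entry is -1, to the rows above and thereby cancels \<open>c\<close>.\<close>
  let ?D = "four_block_mat (1\<^sub>m n) c (0\<^sub>m 1 n) (1\<^sub>m 1)"
  let ?E = "four_block_mat (1\<^sub>m n) (- c) (0\<^sub>m 1 n) (1\<^sub>m 1)"
  have ED: "?E * ?D = 1\<^sub>m (Suc n)"
    by (subst mult_four_block_mat[of _ n n _ 1 _ 1 _ _ n _ 1]) (use c in auto)
  have D: "?D \<in> carrier_mat (Suc n) (Suc n)" "?E \<in> carrier_mat (Suc n) (Suc n)" by auto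
  have "?D * ?F = N" unfolding N_def
    by (subst mult_four_block_mat[of _ n n _ 1 _ 1 _ _ k _ 1]) (use c M in auto)
  then have "det_divisor (Suc k) N = det_divisor (Suc k) ?F"
    using det_divisor_mult_invertible[OF Fc D ED, of "1\<^sub>m (Suc k)" "1\<^sub>m (Suc k)"] N by simp
  also have "det_divisor (Suc k) N = det_divisor k M"
  proof (rule det_divisor_eqI[OF N M])
    fix d
    show "(\<forall>U\<in>carrier_mat (Suc k) (Suc n). d dvd det (U * N)) \<longleftrightarrow> (\<forall>U\<in>carrier_mat k n. d dvd det (U * M))"
    proof safe
      fix U :: "'a poly mat"
      assume a: "\<forall>U\<in>carrier_mat (Suc k) (Suc n). d dvd det (U * N)" and U: "U \<in> carrier_mat k n"
      \<comment> \<open>Bordering \<open>U\<close> by a 1 realises every test determinant of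
        \<open>M\<close>, up to sign, as one of \<open>N\<close>.\<close>
      let ?V = "four_block_mat U (0\<^sub>m k 1) (0\<^sub>m 1 n) (1\<^sub>m 1)"
      have V: "?V \<in> carrier_mat (Suc k) (Suc n)" using U by auto
      have "?V * N = four_block_mat (U * M) (0\<^sub>m k 1) (0\<^sub>m 1 k) (- 1\<^sub>m 1)" unfolding N_def
        by (subst mult_four_block_mat[of _ k n _ 1 _ 1 _ _ k _ 1]) (use U M in auto)
      also have "det \<dots> = det (U * M) * det (- 1\<^sub>m 1)"
        by (rule det_four_block_mat_upper_right_zero) (use U M in auto)
      also have "det (- 1\<^sub>m 1 :: 'a poly mat) = - 1" by (subst det_single) auto
      finally have "det (?V * N) = - det (U * M)" by simp
      then show "d dvd det (U * M)" using a V by (metis dvd_minus_iff)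
    next
      fix U :: "'a poly mat"
      assume a: "\<forall>U\<in>carrier_mat k n. d dvd det (U * M)" and U: "U \<in> carrier_mat (Suc k) (Suc n)"
      have UN: "U * N \<in> carrier_mat (Suc k) (Suc k)" using U N by simp
      \<comment> \<open>For the converse, expand along the last column: deleting it from
        \<open>U * N\<close> leaves products of \<open>M\<close> with \<open>U\<close> stripped of
        one row and of its last column.\<close>
      have "d dvd det (mat_delete (U * N) i k)" if i: "i < Suc k" for i
      proof -
        have "mat_delete (U * N) i k = mat_delete U i n * M"
          by (rule eq_matI) (use U N M i in \<open>auto simp: mat_delete_def N_def scalar_prod_def intro!: sum.cong\<close>)
        moreover have "mat_delete U i n \<in> carrier_mat k n"
          using mat_delete_carrier[OF U] by simp
        ultimately show ?thesis using a by simp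
      qed
      then show "d dvd det (U * N)"
        unfolding laplace_expansion_column[OF UN lessI] cofactor_def
        by (intro dvd_sum dvd_mult) auto
    qed
  qed
  finally show ?thesis unfolding Phi_def F M_def by simp
qed

text \<open>The block matrix \<open>D\<close> extends \<open>Q\<close> by an identity block so that
  \<open>D * J * P = J\<close> for the rectangular identity \<open>J\<close>, because
  \<open>Q * P = 1\<^sub>m k\<close>. Hence the part of the pencil that carries \<open>x\<close> is
  preserved and only \<open>A\<close> changes.\<close>

lemma xI_minus_conjugate:
  fixes A :: "'a::field_gcd mat"
  assumes A: "A \<in> carrier_mat n k" and kn: "k \<le> n"
    and P: "P \<in> carrier_mat k k" and Q: "Q \<in> carrier_mat k k" and QP: "Q * P = 1\<^sub>m k"
  defines "D \<equiv> four_block_mat Q (0\<^sub>m k (n - k)) (0\<^sub>m (n - k) k) (1\<^sub>m (n - k))"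
  shows "xI_minus n k (D * A * P) =
    map_mat (\<lambda>a. [:a:]) D * xI_minus n k A * map_mat (\<lambda>a. [:a:]) P"
proof -
  let ?c = "map_mat (\<lambda>a::'a. [:a:])"
  let ?c' = "map_mat (\<lambda>a::'a. [:a:] * [:0,1:])"
  define J :: "'a mat" where "J = mat n k (\<lambda>(i,j). if i = j then 1 else 0)"
  have J: "J \<in> carrier_mat n k" unfolding J_def by simp
  have D: "D \<in> carrier_mat n n" unfolding D_def using four_block_carrier_mat[OF Q] kn by force
  have xI: "xI_minus n k B = ?c' J - ?c B" if "B \<in> carrier_mat n k" for B
    unfolding xI_minus_def J_def using that by (intro eq_matI) auto
  have DJ: "(D * J) $$ (i,j) = D $$ (i,j)" if "i < n" "j < k" for i j
  proof -
    have "(D * J) $$ (i,j) = (\<Sum>l = 0..<n. D $$ (i,l) * (if l = j then 1 else 0))"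
      using that D kn by (simp add: J_def scalar_prod_def)
    also have "\<dots> = (\<Sum>l = 0..<n. if l = j then D $$ (i,l) else 0)"
      by (rule sum.cong) auto
    also have "\<dots> = D $$ (i,j)" using that kn by simp
    finally show ?thesis .
  qed
  have "D * J * P = J"
  proof (rule eq_matI)
    fix i j assume ij: "i < dim_row J" "j < dim_col J"
    then have ij: "i < n" "j < k" by (auto simp: J_def)
    have entry: "(X * P) $$ (i,j) = (\<Sum>l = 0..<k. X $$ (i,l) * P $$ (l,j))" if "X \<in> carrier_mat n k" for X
      using ij that P by (simp add: scalar_prod_def)
    have "(D * J * P) $$ (i,j) = (\<Sum>l = 0..<k. (D * J) $$ (i,l) * P $$ (l,j))"
      by (rule entry[OF mult_carrier_mat[OF D J]])
    also have "\<dots> = (\<Sum>l = 0..<k. D $$ (i,l) * P $$ (l,j))"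
      by (rule sum.cong) (use ij DJ in auto)
    also have "\<dots> = (if i < k then (Q * P) $$ (i,j) else 0)"
      using ij P Q kn by (auto simp: D_def scalar_prod_def intro!: sum.neutral)
    also have "\<dots> = J $$ (i,j)" using ij QP kn by (simp add: J_def)
    finally show "(D * J * P) $$ (i,j) = J $$ (i,j)" .
  qed (use D J P in auto)
  then have "?c' J = ?c' (D * J * P)" by simp
  also have "\<dots> = ?c D * ?c' J * ?c P"
    unfolding map_poly_mult(2)[OF mult_carrier_mat[OF D J] P] map_poly_mult(3)[OF D J] by (rule refl)
  finally have cJ: "?c' J = ?c D * ?c' J * ?c P" .
  have cA: "?c (D * A * P) = ?c D * ?c A * ?c P"
    unfolding map_poly_mult(1)[OF mult_carrier_mat[OF D A] P] map_poly_mult(1)[OF D A] by (rule refl)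
  have "xI_minus n k (D * A * P) = ?c' J - ?c (D * A * P)" using D A P by (intro xI) auto
  also have "\<dots> = ?c D * ?c' J * ?c P - ?c D * ?c A * ?c P" using cJ cA by simp
  also have "\<dots> = (?c D * ?c' J - ?c D * ?c A) * ?c P"
    by (rule minus_mult_distrib_mat[symmetric, of _ n k]) (use D J A P in auto)
  also have "?c D * ?c' J - ?c D * ?c A = ?c D * (?c' J - ?c A)"
    by (rule mult_minus_distrib_mat[symmetric, of _ n n]) (use D J A in auto)
  finally show ?thesis using xI[OF A] by simp
qed

text \<open>Both factors stay invertible when read over the polynomial ring, so the pencils of the
  two matrices are equivalent.\<close>

lemma Phi_conjugate:
  fixes A :: "'a::field_gcd mat"
  assumes A: "A \<in> carrier_mat n k" and kn: "k \<le> n"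
    and P: "P \<in> carrier_mat k k" and Q: "Q \<in> carrier_mat k k"
    and QP: "Q * P = 1\<^sub>m k" and PQ: "P * Q = 1\<^sub>m k"
  shows "Phi n k (four_block_mat Q (0\<^sub>m k (n - k)) (0\<^sub>m (n - k) k) (1\<^sub>m (n - k)) * A * P) = Phi n k A"
proof -
  let ?c = "map_mat (\<lambda>a::'a. [:a:])"
  let ?B = "\<lambda>Q::'a mat. four_block_mat Q (0\<^sub>m k (n - k)) (0\<^sub>m (n - k) k) (1\<^sub>m (n - k))"
  have B: "?B R \<in> carrier_mat n n" if "R \<in> carrier_mat k k" for R
    using four_block_carrier_mat[OF that] kn by force
  have "?B P * ?B Q = 1\<^sub>m n"
    by (subst mult_four_block_mat[of _ k k _ "n - k" _ "n - k" _ _ k _ "n - k"]) (use P Q PQ kn in auto)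
  moreover have c1: "?c (1\<^sub>m m) = 1\<^sub>m m" for m by (rule eq_matI) auto
  ultimately have "?c (?B P) * ?c (?B Q) = 1\<^sub>m n"
    using map_poly_mult(1)[OF B[OF P] B[OF Q]] by simp
  moreover have "?c P * ?c Q = 1\<^sub>m k" using map_poly_mult(1)[OF P Q] PQ c1 by simp
  ultimately show ?thesis
    unfolding Phi_def xI_minus_conjugate[OF A kn P Q QP]
    using B P Q by (intro det_divisor_mult_invertible[of _ n k _ "?c (?B P)" _ "?c Q"]) (auto simp: xI_minus_def)
qed

subsection \<open>The recursion in the size of the matrix\<close>

lemma bij_betw_mat: "bij_betw (mat n k) (({..<n} \<times> {..<k}) \<rightarrow>\<^sub>E UNIV) (carrier_mat n k)"
proof (rule bij_betw_byWitness[where f' = "\<lambda>A. restrict (\<lambda>p. A $$ p) ({..<n} \<times> {..<k})"])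
  show "\<forall>f\<in>({..<n} \<times> {..<k}) \<rightarrow>\<^sub>E UNIV. restrict (\<lambda>p. mat n k f $$ p) ({..<n} \<times> {..<k}) = f"
    by (auto simp: fun_eq_iff PiE_iff extensional_def restrict_def)
  show "\<forall>A\<in>carrier_mat n k. mat n k (restrict (\<lambda>p. A $$ p) ({..<n} \<times> {..<k})) = A"
    by (auto intro!: eq_matI)
qed (simp_all add: image_subset_iff)

lemma card_carrier_mat:
  "card (carrier_mat n k :: 'a::finite mat set) = card (UNIV :: 'a set) ^ (n * k)"
  using bij_betw_same_card[OF bij_betw_mat[where 'a='a, of n k]]
  by (simp add: card_PiE card_cartesian_product)

lemma finite_carrier_mat: "finite (carrier_mat n k :: 'a::finite mat set)"
  using bij_betw_finite[OF bij_betw_mat[where 'a='a, of n k]] by (simp add: finite_PiE)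

lemma bij_betw_vec: "bij_betw (vec n) ({..<n} \<rightarrow>\<^sub>E UNIV) (carrier_vec n)"
proof (rule bij_betw_byWitness[where f' = "\<lambda>v. restrict (\<lambda>i. v $ i) {..<n}"])
  show "\<forall>f\<in>{..<n} \<rightarrow>\<^sub>E UNIV. restrict (\<lambda>i. vec n f $ i) {..<n} = f"
    by (auto simp: fun_eq_iff PiE_iff extensional_def restrict_def)
  show "\<forall>v\<in>carrier_vec n. vec n (restrict (\<lambda>i. v $ i) {..<n}) = v"
    by (auto intro!: eq_vecI)
qed (simp_all add: image_subset_iff)

lemma card_carrier_vec: "card (carrier_vec n :: 'a::finite vec set) = card (UNIV :: 'a set) ^ n"
  using bij_betw_same_card[OF bij_betw_vec[where 'a='a, of n]] by (simp add: card_PiE)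

lemma finite_carrier_vec: "finite (carrier_vec n :: 'a::finite vec set)"
  using bij_betw_finite[OF bij_betw_vec[where 'a='a, of n]] by (simp add: finite_PiE)

lemma card_eq_sum_fibres:
  assumes "finite A" "finite B" "g ` A \<subseteq> B"
  shows "card A = (\<Sum>b\<in>B. card {a\<in>A. g a = b})"
proof -
  have "A = (\<Union>b\<in>B. {a\<in>A. g a = b})" using assms by auto
  then have "card A = card (\<Union>b\<in>B. {a\<in>A. g a = b})" by simp
  also have "\<dots> = (\<Sum>b\<in>B. card {a\<in>A. g a = b})"
    by (rule card_UN_disjoint) (use assms in auto)
  finally show ?thesis .
qed

section \<open>Fibres with a prescribed last row\<close>

definition Phi_fibre :: "nat \<Rightarrow> nat \<Rightarrow> 'a::field_gcd poly \<Rightarrow> 'a mat set" where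
  "Phi_fibre n k f = {A \<in> carrier_mat n k. Phi n k A = f}"

definition Phi_row_fibre :: "nat \<Rightarrow> nat \<Rightarrow> 'a::field_gcd poly \<Rightarrow> 'a vec \<Rightarrow> 'a mat set" where
  "Phi_row_fibre n k f y = {A \<in> Phi_fibre (Suc n) k f. row A n = y}"

lemma card_Phi_row_fibre_zero:
  assumes kn: "k \<le> n"
  shows "card (Phi_row_fibre n k f (0\<^sub>v k)) = card (Phi_fibre n k f)"
proof -
  let ?g = "\<lambda>A. mat (Suc n) k (\<lambda>(i,j). if i < n then A $$ (i,j) else 0)"
  let ?h = "\<lambda>A. mat n k (\<lambda>(i,j). A $$ (i,j))"
  have hg: "?h (?g A) = A" if "A \<in> carrier_mat n k" for A :: "'a mat"
    using that by (intro eq_matI) auto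
  have gh: "?g (?h A) = A" if "A \<in> carrier_mat (Suc n) k" "row A n = 0\<^sub>v k" for A :: "'a mat"
  proof (rule eq_matI)
    have last: "A $$ (n,j) = 0" if "j < k" for j
      using arg_cong[OF \<open>row A n = 0\<^sub>v k\<close>, of "\<lambda>v. v $ j"] that \<open>A \<in> carrier_mat (Suc n) k\<close> by simp
    show "?g (?h A) $$ (i,j) = A $$ (i,j)" if "i < dim_row A" "j < dim_col A" for i j
      using that last \<open>A \<in> carrier_mat (Suc n) k\<close> by (auto simp: less_Suc_eq)
  qed (use that in auto)
  have "bij_betw ?g (Phi_fibre n k f) (Phi_row_fibre n k f (0\<^sub>v k))"
  proof (rule bij_betw_byWitness[where f' = ?h])
    show "\<forall>A\<in>Phi_fibre n k f. ?h (?g A) = A" using hg by (auto simp: Phi_fibre_def)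
    show "\<forall>A\<in>Phi_row_fibre n k f (0\<^sub>v k). ?g (?h A) = A"
      using gh by (auto simp: Phi_row_fibre_def Phi_fibre_def)
    show "?g ` Phi_fibre n k f \<subseteq> Phi_row_fibre n k f (0\<^sub>v k)"
      using Phi_append_zero_row[OF _ kn] by (auto simp: Phi_row_fibre_def Phi_fibre_def)
    show "?h ` Phi_row_fibre n k f (0\<^sub>v k) \<subseteq> Phi_fibre n k f"
    proof safe
      fix A assume A: "A \<in> Phi_row_fibre n k f (0\<^sub>v k)"
      then have "?g (?h A) = A" using gh by (auto simp: Phi_row_fibre_def Phi_fibre_def)
      then show "?h A \<in> Phi_fibre n k f" using A Phi_append_zero_row[OF _ kn, of "?h A"]
        by (auto simp: Phi_row_fibre_def Phi_fibre_def)
    qed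
  qed
  then show ?thesis using bij_betw_same_card by fastforce
qed

text \<open>Above the unit entry the last column is arbitrary, which accounts for the factor
  \<open>q ^ n\<close>; the rest is a matrix in the smaller fibre.\<close>

lemma card_Phi_row_fibre_unit:
  fixes f :: "'a::{field_gcd,finite} poly"
  assumes kn: "k < n"
  shows "card (Phi_row_fibre n (Suc k) f (unit_vec (Suc k) k)) = card (UNIV :: 'a set) ^ n * card (Phi_fibre n k f)"
proof -
  let ?g = "\<lambda>(A, b). four_block_mat A b (0\<^sub>m 1 k) (1\<^sub>m 1)"
  let ?h = "\<lambda>A. (mat n k (\<lambda>(i,j). A $$ (i,j)), mat n 1 (\<lambda>(i,j). A $$ (i,k)))"
  have hg: "?h (?g (A, b)) = (A, b)" if "A \<in> carrier_mat n k" "b \<in> carrier_mat n 1" for A b :: "'a mat"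
    using that by (auto intro!: eq_matI)
  have gh: "?g (?h A) = A" if "A \<in> carrier_mat (Suc n) (Suc k)" "row A n = unit_vec (Suc k) k" for A :: "'a mat"
  proof (rule eq_matI)
    have last: "A $$ (n,j) = (if j = k then 1 else 0)" if "j < Suc k" for j
      using arg_cong[OF \<open>row A n = _\<close>, of "\<lambda>v. v $ j"] that \<open>A \<in> carrier_mat (Suc n) (Suc k)\<close> by simp
    show "?g (?h A) $$ (i,j) = A $$ (i,j)" if "i < dim_row A" "j < dim_col A" for i j
      using that last \<open>A \<in> carrier_mat (Suc n) (Suc k)\<close> by (auto simp: less_Suc_eq)
  qed (use that in auto)
  have "bij_betw ?g (Phi_fibre n k f \<times> carrier_mat n 1) (Phi_row_fibre n (Suc k) f (unit_vec (Suc k) k))"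
  proof (rule bij_betw_byWitness[where f' = ?h])
    show "\<forall>p\<in>Phi_fibre n k f \<times> carrier_mat n 1. ?h (?g p) = p"
      using hg by (auto simp: Phi_fibre_def)
    show "\<forall>A\<in>Phi_row_fibre n (Suc k) f (unit_vec (Suc k) k). ?g (?h A) = A"
      using gh by (auto simp: Phi_row_fibre_def Phi_fibre_def)
    show "?g ` (Phi_fibre n k f \<times> carrier_mat n 1) \<subseteq> Phi_row_fibre n (Suc k) f (unit_vec (Suc k) k)"
    proof
      fix B assume "B \<in> ?g ` (Phi_fibre n k f \<times> carrier_mat n 1)"
      then obtain A b where A: "A \<in> Phi_fibre n k f" and b: "b \<in> carrier_mat n 1"
        and B: "B = ?g (A, b)" by auto
      then have "row (?g (A, b)) n = unit_vec (Suc k) k"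
        by (auto simp: Phi_fibre_def intro!: eq_vecI)
      moreover have "?g (A, b) \<in> carrier_mat (Suc n) (Suc k)"
        using A by (auto simp: Phi_fibre_def)
      ultimately show "B \<in> Phi_row_fibre n (Suc k) f (unit_vec (Suc k) k)"
        using A Phi_append_unit_row[OF _ b kn, of A] unfolding B
        by (simp add: Phi_row_fibre_def Phi_fibre_def)
    qed
    show "?h ` Phi_row_fibre n (Suc k) f (unit_vec (Suc k) k) \<subseteq> Phi_fibre n k f \<times> carrier_mat n 1"
    proof
      fix p assume "p \<in> ?h ` Phi_row_fibre n (Suc k) f (unit_vec (Suc k) k)"
      then obtain A where A: "A \<in> Phi_row_fibre n (Suc k) f (unit_vec (Suc k) k)" and p: "p = ?h A" by auto
      then have "?g (?h A) = A" using gh by (auto simp: Phi_row_fibre_def Phi_fibre_def)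
      then have "Phi n k (fst (?h A)) = f"
        using A Phi_append_unit_row[OF _ _ kn, of "fst (?h A)" "snd (?h A)"]
        by (simp add: Phi_row_fibre_def Phi_fibre_def)
      then show "p \<in> Phi_fibre n k f \<times> carrier_mat n 1"
        unfolding p by (simp add: Phi_fibre_def)
    qed
  qed
  from bij_betw_same_card[OF this] show ?thesis
    by (simp add: card_cartesian_product card_carrier_mat mult.commute)
qed

text \<open>If \<open>P\<close> is invertible with row \<open>k\<close> equal to \<open>y\<close>,
  then \<open>y\<close> times the inverse of \<open>P\<close> is the unit vector. Conjugation by
  \<open>P\<close>, extended by an identity block on the left, therefore matches the two fibres and
  preserves \<open>Phi\<close>.\<close>

lemma card_Phi_row_fibre_nonzero:
  fixes y :: "'a::{field_gcd,finite} vec"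
  assumes kn: "k < n" and y: "y \<in> carrier_vec (Suc k)" "y \<noteq> 0\<^sub>v (Suc k)"
  shows "card (Phi_row_fibre n (Suc k) f y) = card (Phi_row_fibre n (Suc k) f (unit_vec (Suc k) k))"
proof -
  define K where "K = Suc k"
  define m where "m = Suc n - K"
  have Kn: "K \<le> Suc n" "K \<le> n" "k < K" and m: "K + m = Suc n" using kn unfolding K_def m_def by auto
  obtain s where s: "s < K" "y $ s \<noteq> 0"
    using y unfolding K_def by (metis carrier_vecD eq_vecI index_zero_vec)
  obtain P' Q' where P': "P' \<in> carrier_mat K K" and Q': "Q' \<in> carrier_mat K K"
    and PQ': "P' * Q' = 1\<^sub>m K" "Q' * P' = 1\<^sub>m K" "col P' k = y"
    using invertible_mat_with_column[of k K s y] s y Kn unfolding K_def by blast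
  \<comment> \<open>The base change available has a prescribed column; the transpose turns it into a
    prescribed row.\<close>
  define P where "P = transpose_mat P'"
  define Q where "Q = transpose_mat Q'"
  have P: "P \<in> carrier_mat K K" and Q: "Q \<in> carrier_mat K K" using P' Q' by (auto simp: P_def Q_def)
  have PQ: "P * Q = 1\<^sub>m K" "Q * P = 1\<^sub>m K"
    using arg_cong[OF PQ'(2), of transpose_mat] arg_cong[OF PQ'(1), of transpose_mat]
    by (simp_all add: P_def Q_def transpose_mult[OF Q' P'] transpose_mult[OF P' Q'])
  have rowP: "row P k = y" using PQ'(3) P' Kn by (simp add: P_def)
  define D :: "'a mat \<Rightarrow> 'a mat" where
    "D = (\<lambda>R. four_block_mat R (0\<^sub>m K m) (0\<^sub>m m K) (1\<^sub>m m))"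
  have D: "D R \<in> carrier_mat (Suc n) (Suc n)" if "R \<in> carrier_mat K K" for R
    using four_block_carrier_mat[OF that, of "1\<^sub>m m" m m] m unfolding D_def by simp
  have DD: "D R * D S = 1\<^sub>m (Suc n)" if "R \<in> carrier_mat K K" "S \<in> carrier_mat K K" "R * S = 1\<^sub>m K" for R S
    unfolding D_def m[symmetric]
    by (subst mult_four_block_mat[of _ K K _ m _ m _ _ K _ m]) (use that in auto)
  have conj: "D S * (D R * A * S) * R = A"
    if "R \<in> carrier_mat K K" "S \<in> carrier_mat K K" "R * S = 1\<^sub>m K" "S * R = 1\<^sub>m K"
      "A \<in> carrier_mat (Suc n) K" for R S A
  proof -
    have "D S * (D R * A * S) * R = (D S * D R) * A * (S * R)"
      using that D[OF that(1)] D[OF that(2)]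
      by (simp add: assoc_mult_mat[of _ "Suc n" "Suc n" _ "Suc n" _ K] assoc_mult_mat[of _ "Suc n" "Suc n" _ K _ K]
        assoc_mult_mat[of _ "Suc n" K _ K _ K])
    then show ?thesis using that DD[OF that(2,1)] by simp
  qed
  have last: "row (D R * A * S) n = row (A * S) n"
    if "R \<in> carrier_mat K K" "S \<in> carrier_mat K K" "A \<in> carrier_mat (Suc n) K" for R S A
  proof -
    \<comment> \<open>The last row lies in the identity block because \<open>K \<le> n\<close>, so
      only the right factor acts on it.\<close>
    have "row (D R) n = unit_vec (Suc n) n"
      by (rule eq_vecI) (use that Kn m in \<open>auto simp: D_def\<close>)
    then have "row (D R * A) n = row A n"
      using that D[OF that(1)] by (intro eq_vecI) auto
    then show ?thesis
      using that D[OF that(1)] by (intro eq_vecI) (auto simp del: assoc_mult_mat)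
  qed
  have Phi: "Phi (Suc n) K (D R * A * S) = Phi (Suc n) K A"
    if "R \<in> carrier_mat K K" "S \<in> carrier_mat K K" "R * S = 1\<^sub>m K" "S * R = 1\<^sub>m K"
      "A \<in> carrier_mat (Suc n) K" for R S A
    unfolding D_def m_def using that Kn by (intro Phi_conjugate) auto
  have "bij_betw (\<lambda>A. D P * A * Q) (Phi_row_fibre n K f y) (Phi_row_fibre n K f (unit_vec K k))"
  proof (rule bij_betw_byWitness[where f' = "\<lambda>A. D Q * A * P"])
    show "\<forall>A\<in>Phi_row_fibre n K f y. D Q * (D P * A * Q) * P = A"
      using conj[OF P Q PQ] by (auto simp: Phi_row_fibre_def Phi_fibre_def)
    show "\<forall>A\<in>Phi_row_fibre n K f (unit_vec K k). D P * (D Q * A * P) * Q = A"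
      using conj[OF Q P PQ(2,1)] by (auto simp: Phi_row_fibre_def Phi_fibre_def)
    show "(\<lambda>A. D P * A * Q) ` Phi_row_fibre n K f y \<subseteq> Phi_row_fibre n K f (unit_vec K k)"
    proof safe
      fix A assume "A \<in> Phi_row_fibre n K f y"
      then have A: "A \<in> carrier_mat (Suc n) K" "Phi (Suc n) K A = f" "row A n = y"
        by (auto simp: Phi_row_fibre_def Phi_fibre_def)
      have "row (A * Q) n = row (P * Q) k"
        by (rule eq_vecI) (use A P Q rowP Kn in auto)
      then show "D P * A * Q \<in> Phi_row_fibre n K f (unit_vec K k)"
        using Phi[OF P Q PQ A(1)] last[OF P Q A(1)] A D[OF P] Q PQ Kn
        by (auto simp: Phi_row_fibre_def Phi_fibre_def)
    qed
    show "(\<lambda>A. D Q * A * P) ` Phi_row_fibre n K f (unit_vec K k) \<subseteq> Phi_row_fibre n K f y"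
    proof safe
      fix A assume "A \<in> Phi_row_fibre n K f (unit_vec K k)"
      then have A: "A \<in> carrier_mat (Suc n) K" "Phi (Suc n) K A = f" "row A n = unit_vec K k"
        by (auto simp: Phi_row_fibre_def Phi_fibre_def)
      have "row (A * P) n = y"
        by (rule eq_vecI) (use A P rowP Kn in auto)
      then show "D Q * A * P \<in> Phi_row_fibre n K f y"
        using Phi[OF Q P PQ(2,1) A(1)] last[OF Q P A(1)] A D[OF Q] P
        by (auto simp: Phi_row_fibre_def Phi_fibre_def)
    qed
  qed
  then show ?thesis unfolding K_def by (rule bij_betw_same_card)
qed

text \<open>Classify by the last row: the zero row gives the fibre with one row less, and the
  \<open>q ^ Suc k - 1\<close> nonzero rows all contribute the same amount.\<close>

lemma card_Phi_fibre_Suc: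
  fixes f :: "'a::{field_gcd,finite} poly"
  assumes kn: "k < n"
  shows "card (Phi_fibre (Suc n) (Suc k) f) =
    card (Phi_fibre n (Suc k) f) + (card (UNIV :: 'a set) ^ Suc k - 1) * (card (UNIV :: 'a set) ^ n * card (Phi_fibre n k f))"
proof -
  let ?V = "carrier_vec (Suc k) :: 'a vec set"
  have fin: "finite (Phi_fibre (Suc n) (Suc k) f)"
    by (rule finite_subset[OF _ finite_carrier_mat[of "Suc n" "Suc k"]]) (auto simp: Phi_fibre_def)
  have img: "(\<lambda>A. row A n) ` Phi_fibre (Suc n) (Suc k) f \<subseteq> ?V"
  proof
    fix y assume "y \<in> (\<lambda>A. row A n) ` Phi_fibre (Suc n) (Suc k) f"
    then obtain A where "A \<in> carrier_mat (Suc n) (Suc k)" "y = row A n"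
      unfolding Phi_fibre_def by blast
    then show "y \<in> ?V" by (auto intro: carrier_vecI)
  qed
  have "card (Phi_fibre (Suc n) (Suc k) f) = (\<Sum>y\<in>?V. card (Phi_row_fibre n (Suc k) f y))"
    unfolding Phi_row_fibre_def by (rule card_eq_sum_fibres[OF fin finite_carrier_vec img])
  also have "\<dots> = card (Phi_row_fibre n (Suc k) f (0\<^sub>v (Suc k))) +
      (\<Sum>y\<in>?V - {0\<^sub>v (Suc k)}. card (Phi_row_fibre n (Suc k) f y))"
    by (rule sum.remove) (auto simp: finite_carrier_vec)
  also have "(\<Sum>y\<in>?V - {0\<^sub>v (Suc k)}. card (Phi_row_fibre n (Suc k) f y)) =
      (\<Sum>y\<in>?V - {0\<^sub>v (Suc k)}. card (UNIV :: 'a set) ^ n * card (Phi_fibre n k f))"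
    by (rule sum.cong) (simp_all add: card_Phi_row_fibre_nonzero[OF kn] card_Phi_row_fibre_unit[OF kn])
  finally show ?thesis
    using kn by (simp add: card_Phi_row_fibre_zero card_carrier_vec finite_carrier_vec)
qed

subsection \<open>Matrices with a given characteristic polynomial\<close>

lemma det_companion:
  fixes x :: "'b::comm_ring_1"
  shows "det (mat (Suc m) (Suc m) (\<lambda>(r,c). (if r = c then x else 0) +
      (if c = m then a r else if r = Suc c then - 1 else 0))) =
    x ^ Suc m + (\<Sum>r\<le>m. a r * x ^ r)"
proof (induction m arbitrary: a)
  case 0
  show ?case by (subst det_single) auto
next
  case (Suc m)
  define A where "A = mat (Suc (Suc m)) (Suc (Suc m)) (\<lambda>(r,c). (if r = c then x else 0) +
      (if c = Suc m then a r else if r = Suc c then - 1 else 0))"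
  have A: "A \<in> carrier_mat (Suc (Suc m)) (Suc (Suc m))" unfolding A_def by simp
  have "mat_delete A 0 0 = mat (Suc m) (Suc m) (\<lambda>(r,c). (if r = c then x else 0) +
      (if c = m then a (Suc r) else if r = Suc c then - 1 else 0))"
    by (rule eq_matI) (auto simp: mat_delete_def A_def)
  then have c0: "cofactor A 0 0 = x ^ Suc m + (\<Sum>r\<le>m. a (Suc r) * x ^ r)"
    unfolding cofactor_def using Suc.IH[of "\<lambda>r. a (Suc r)"] by simp
  let ?B = "mat_delete A 0 (Suc m)"
  have B: "?B \<in> carrier_mat (Suc m) (Suc m)" using mat_delete_carrier[OF A] by simp
  have "det ?B = prod_list (diag_mat ?B)"
    by (rule det_upper_triangular[OF _ B]) (auto simp: upper_triangular_def mat_delete_def A_def)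
  also have "diag_mat ?B = map (\<lambda>i. - 1) [0..<Suc m]"
    unfolding diag_mat_def using B by (intro map_cong) (auto simp: mat_delete_def A_def)
  also have "prod_list \<dots> = (- 1 :: 'b) ^ Suc m" by (simp add: map_replicate_const del: upt_Suc)
  finally have c1: "cofactor A 0 (Suc m) = 1"
    unfolding cofactor_def by (simp add: power_add[symmetric] flip: power_mult_distrib)
  \<comment> \<open>The first row has only the entries \<open>x\<close> and \<open>a 0\<close> to
    offer. The minor of \<open>x\<close> has the same shape with \<open>a\<close> shifted; that of
    the corner is triangular with diagonal -1, and its sign cancels the sign of the
    cofactor.\<close>
  have "det A = (\<Sum>j<Suc (Suc m). A $$ (0,j) * cofactor A 0 j)"
    by (rule laplace_expansion_row[OF A]) simp
  also have "\<dots> = (\<Sum>j\<in>{0, Suc m}. A $$ (0,j) * cofactor A 0 j)"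
    by (rule sum.mono_neutral_right) (auto simp: A_def)
  also have "\<dots> = x * (x ^ Suc m + (\<Sum>r\<le>m. a (Suc r) * x ^ r)) + a 0"
    by (simp add: c0 c1) (simp add: A_def)
  also have "\<dots> = x ^ Suc (Suc m) + (\<Sum>r\<le>Suc m. a r * x ^ r)"
    by (simp add: sum.atMost_Suc_shift algebra_simps sum_distrib_left del: sum.atMost_Suc)
  finally show ?case unfolding A_def .
qed

text \<open>For monic \<open>h\<close> of degree \<open>m\<close> this is multiplication by
  \<open>x\<close> modulo \<open>h\<close> in the basis of powers of \<open>x\<close>.\<close>

definition companion :: "nat \<Rightarrow> 'a::comm_ring_1 poly \<Rightarrow> 'a mat" where
  "companion m h = mat m m (\<lambda>(r,c). if c = m - 1 then - coeff h r else if r = Suc c then 1 else 0)"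

lemma companion_carrier [simp]: "companion m h \<in> carrier_mat m m"
  unfolding companion_def by simp

lemma char_poly_companion:
  fixes h :: "'a::field poly"
  assumes h: "lead_coeff h = 1" "degree h = Suc m"
  shows "char_poly (companion (Suc m) h) = h"
proof -
  have "char_poly_matrix (companion (Suc m) h) =
     mat (Suc m) (Suc m) (\<lambda>(r,c). (if r = c then [:0,1:] else 0) +
      (if c = m then [:coeff h r:] else if r = Suc c then - 1 else 0))"
    unfolding char_poly_matrix_def
    by (rule eq_matI) (auto simp: companion_def one_pCons)
  then have "char_poly (companion (Suc m) h) = [:0,1:] ^ Suc m + (\<Sum>r\<le>m. [:coeff h r:] * [:0,1:] ^ r)"
    unfolding char_poly_def by (simp only: det_companion)
  also have "\<dots> = (\<Sum>r\<le>Suc m. monom (coeff h r) r)"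
    using h by (simp add: monom_altdef add.commute)
  also have "\<dots> = h" using poly_as_sum_of_monoms[of h] h by simp
  finally show ?thesis .
qed

lemma char_poly_block_triangular:
  fixes A :: "'a::idom mat"
  assumes A: "A \<in> carrier_mat m m" and B: "B \<in> carrier_mat m l" and D: "D \<in> carrier_mat l l"
  shows "char_poly (four_block_mat A B (0\<^sub>m l m) D) = char_poly A * char_poly D"
proof -
  have "char_poly_matrix (four_block_mat A B (0\<^sub>m l m) D) =
    four_block_mat (char_poly_matrix A) (map_mat (\<lambda>a. [:-a:]) B) (0\<^sub>m l m) (char_poly_matrix D)"
    unfolding char_poly_matrix_def by (rule eq_matI) (use A B D in auto)
  then show ?thesis unfolding char_poly_def
    using det_four_block_mat_lower_left_zero[of "char_poly_matrix A" m "map_mat (\<lambda>a. [:-a:]) B" l _ "char_poly_matrix D"]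
    A B D by simp
qed

lemma finite_poly_degree_le: "finite {p :: 'a::{finite,comm_ring_1} poly. degree p \<le> m}"
proof (rule finite_subset)
  show "{p :: 'a poly. degree p \<le> m} \<subseteq> Poly ` {xs. set xs \<subseteq> UNIV \<and> length xs \<le> Suc m}"
  proof
    fix p :: "'a poly" assume "p \<in> {p. degree p \<le> m}"
    then have "length (coeffs p) \<le> Suc m" by (cases "p = 0") (auto simp: length_coeffs_degree)
    then show "p \<in> Poly ` {xs. set xs \<subseteq> UNIV \<and> length xs \<le> Suc m}"
      by (intro image_eqI[of _ _ "coeffs p"]) auto
  qed
  show "finite (Poly ` {xs. set xs \<subseteq> (UNIV :: 'a set) \<and> length xs \<le> Suc m})"
    by (intro finite_imageI finite_lists_length_le) simp
qed

section \<open>Splitting the fibres along a Krylov sequence\<close>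

definition char_fibre :: "nat \<Rightarrow> 'a::field poly \<Rightarrow> 'a mat set" where
  "char_fibre k f = {X \<in> carrier_mat k k. char_poly X = f}"

text \<open>Being monic selects one divisor from each class of associates, so that sums over
  divisors count each class once.\<close>

definition monic_divisors :: "'a::field poly \<Rightarrow> 'a poly set" where
  "monic_divisors f = {g. lead_coeff g = 1 \<and> g dvd f}"

text \<open>The matrices for which the first \<open>j + 1\<close> unit vectors form the beginning of a Krylov sequence.\<close>

definition shift_fibre :: "nat \<Rightarrow> nat \<Rightarrow> 'a::field poly \<Rightarrow> 'a mat set" where
  "shift_fibre j k f = {X \<in> char_fibre k f. \<forall>i<j. col X i = unit_vec k (Suc i)}"

lemma finite_char_fibre: "finite (char_fibre k f :: 'a::{field,finite} mat set)"
  by (rule finite_subset[OF _ finite_carrier_mat[of k k]]) (auto simp: char_fibre_def)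

lemma finite_shift_fibre: "finite (shift_fibre j k f :: 'a::{field,finite} mat set)"
  by (rule finite_subset[OF _ finite_char_fibre[of k f]]) (auto simp: shift_fibre_def)

lemma mult_mat_unit_vec:
  fixes A :: "'a::comm_ring_1 mat"
  assumes "A \<in> carrier_mat n k" "i < k"
  shows "A *\<^sub>v unit_vec k i = col A i"
  using assms by (intro eq_vecI) (auto simp: scalar_prod_right_unit)

text \<open>The entry \<open>w $ s\<close> with \<open>s > j\<close> shows that \<open>w\<close> is
  independent of the unit vectors with index at most \<open>j\<close>. A base change that fixes
  these and sends the next unit vector to \<open>w\<close> makes the Krylov sequence one step
  longer; conjugation keeps the characteristic polynomial.\<close>

lemma card_shift_fibre_col_leaving:
  fixes w :: "'a::{field,finite} vec"
  assumes w: "w \<in> carrier_vec k" and s: "s < k" "Suc j \<le> s" "w $ s \<noteq> 0"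
  shows "card {X \<in> shift_fibre j k f. col X j = w} = card (shift_fibre (Suc j) k f)"
proof -
  have jk: "Suc j < k" using s by simp
  \<comment> \<open>Both altered columns, \<open>Suc j\<close> and \<open>s\<close>, lie beyond
    \<open>j\<close>.\<close>
  obtain P Q where P: "P \<in> carrier_mat k k" and Q: "Q \<in> carrier_mat k k"
    and PQ: "P * Q = 1\<^sub>m k" "Q * P = 1\<^sub>m k" and Pw: "col P (Suc j) = w"
    and Pi: "\<And>i. i < k \<Longrightarrow> i \<noteq> Suc j \<Longrightarrow> i \<noteq> s \<Longrightarrow> col P i = unit_vec k i"
    using invertible_mat_with_column[OF jk s(1) w s(3)] by blast
  have Pe: "P *\<^sub>v unit_vec k i = unit_vec k i" if "i \<le> j" for i
    using Pi[of i] that s P by (simp add: mult_mat_unit_vec)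
  have Pw': "P *\<^sub>v unit_vec k (Suc j) = w"
    using Pw jk P by (simp add: mult_mat_unit_vec)
  have Qcancel: "Q *\<^sub>v (P *\<^sub>v v) = v" if "v \<in> carrier_vec k" for v
    using assoc_mult_mat_vec[OF Q P that] PQ that by simp
  have Qe: "Q *\<^sub>v unit_vec k i = unit_vec k i" if "i \<le> j" for i
    using Qcancel[of "unit_vec k i"] Pe[OF that] by simp
  have Qw: "Q *\<^sub>v w = unit_vec k (Suc j)" using Qcancel[of "unit_vec k (Suc j)"] Pw' by simp
  have col_conj: "col (R * X * S) i = R *\<^sub>v (X *\<^sub>v (S *\<^sub>v unit_vec k i))"
    if "R \<in> carrier_mat k k" "X \<in> carrier_mat k k" "S \<in> carrier_mat k k" "i < k" for R X S :: "'a mat" and i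
  proof -
    have "col (R * X * S) i = R * X * S *\<^sub>v unit_vec k i"
      using that by (intro mult_mat_unit_vec[symmetric]) auto
    also have "\<dots> = R * X *\<^sub>v (S *\<^sub>v unit_vec k i)"
      using that by (intro assoc_mult_mat_vec[of _ k k _ k]) auto
    also have "\<dots> = R *\<^sub>v (X *\<^sub>v (S *\<^sub>v unit_vec k i))"
      using that by (intro assoc_mult_mat_vec[of _ k k _ k]) auto
    finally show ?thesis .
  qed
  have col_unit: "X *\<^sub>v unit_vec k i = col X i" if "X \<in> carrier_mat k k" "i < k" for X :: "'a mat" and i
    using that by (simp add: mult_mat_unit_vec)
  have similar: "char_poly (R * X * S) = char_poly X"
    if "R \<in> carrier_mat k k" "X \<in> carrier_mat k k" "S \<in> carrier_mat k k" "R * S = 1\<^sub>m k" "S * R = 1\<^sub>m k" for R X S :: "'a mat"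
    by (rule char_poly_similar) (use that in \<open>auto intro!: similar_matI[of _ _ R S k]\<close>)
  have cancel: "S * (R * X * S) * R = X"
    if "R \<in> carrier_mat k k" "X \<in> carrier_mat k k" "S \<in> carrier_mat k k" "S * R = 1\<^sub>m k" for R X S :: "'a mat"
  proof -
    have "S * (R * X * S) * R = S * (R * (X * (S * R)))"
      using that by (simp add: assoc_mult_mat[of _ k k _ k _ k])
    also have "\<dots> = S * (R * X)" using that by simp
    also have "\<dots> = S * R * X" by (rule assoc_mult_mat[symmetric]) (use that in auto)
    also have "\<dots> = X" unfolding that(4) using that by simp
    finally show ?thesis .
  qed
  have "bij_betw (\<lambda>X. Q * X * P) {X \<in> shift_fibre j k f. col X j = w} (shift_fibre (Suc j) k f)"
  proof (rule bij_betw_byWitness[where f' = "\<lambda>X. P * X * Q"])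
    show "\<forall>X\<in>{X \<in> shift_fibre j k f. col X j = w}. P * (Q * X * P) * Q = X"
      using cancel[OF Q _ P PQ(1)] by (auto simp: shift_fibre_def char_fibre_def)
    show "\<forall>X\<in>shift_fibre (Suc j) k f. Q * (P * X * Q) * P = X"
      using cancel[OF P _ Q PQ(2)] by (auto simp: shift_fibre_def char_fibre_def)
    show "(\<lambda>X. Q * X * P) ` {X \<in> shift_fibre j k f. col X j = w} \<subseteq> shift_fibre (Suc j) k f"
    proof safe
      fix X assume "X \<in> shift_fibre j k f" and Xw: "w = col X j"
      then have X: "X \<in> carrier_mat k k" "char_poly X = f" "\<And>i. i < j \<Longrightarrow> col X i = unit_vec k (Suc i)"
        by (auto simp: shift_fibre_def char_fibre_def)
      have "col (Q * X * P) i = unit_vec k (Suc i)" if "i < Suc j" for i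
        using that jk col_conj[OF Q X(1) P, of i] Pe[of i] Qe[of "Suc i"] Qw X(3)[of i] Xw
          col_unit[OF X(1), of i] by (cases "i = j") auto
      then show "Q * X * P \<in> shift_fibre (Suc j) k f"
        using similar[OF Q X(1) P PQ(2,1)] X P Q by (auto simp: shift_fibre_def char_fibre_def)
    qed
    show "(\<lambda>X. P * X * Q) ` shift_fibre (Suc j) k f \<subseteq> {X \<in> shift_fibre j k f. col X j = w}"
    proof safe
      fix X assume "X \<in> shift_fibre (Suc j) k f"
      then have X: "X \<in> carrier_mat k k" "char_poly X = f" "\<And>i. i < Suc j \<Longrightarrow> col X i = unit_vec k (Suc i)"
        by (auto simp: shift_fibre_def char_fibre_def)
      have *: "col (P * X * Q) i = P *\<^sub>v unit_vec k (Suc i)" if "i < Suc j" for i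
        using that jk col_conj[OF P X(1) Q, of i] Qe[of i] X(3)[of i] col_unit[OF X(1), of i] by auto
      show "P * X * Q \<in> shift_fibre j k f"
        using similar[OF P X(1) Q PQ] X P Q * Pe by (auto simp: shift_fibre_def char_fibre_def)
      show "col (P * X * Q) j = w" using *[of j] Pw' by simp
    qed
  qed
  then show ?thesis by (rule bij_betw_same_card)
qed

text \<open>Here the unit vectors with index at most \<open>j\<close> span an invariant subspace.
  The matrix is block triangular with a companion block of some \<open>h\<close>, an arbitrary block
  above the diagonal and a block with characteristic polynomial \<open>f div h\<close>; each such
  triple occurs exactly once.\<close>

lemma card_shift_fibre_col_staying:
  fixes f :: "'a::{field,finite} poly"
  assumes jk: "Suc j \<le> k"
  shows "card {X \<in> shift_fibre j k f. \<forall>i. j < i \<and> i < k \<longrightarrow> X $$ (i,j) = 0} =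
    (\<Sum>h\<in>{h \<in> monic_divisors f. degree h = Suc j}.
      card (UNIV :: 'a set) ^ (Suc j * (k - Suc j)) * card (char_fibre (k - Suc j) (f div h)))"
proof -
  define l where "l = k - Suc j"
  have k: "k = Suc j + l" using jk unfolding l_def by simp
  define H where "H = {h \<in> monic_divisors f. degree h = Suc j}"
  define S :: "('a poly \<times> 'a mat \<times> 'a mat) set" where
    "S = (SIGMA h:H. carrier_mat (Suc j) l \<times> char_fibre l (f div h))"
  define T where "T = {X \<in> shift_fibre j k f. \<forall>i. j < i \<and> i < k \<longrightarrow> X $$ (i,j) = 0}"
  define g :: "'a poly \<times> 'a mat \<times> 'a mat \<Rightarrow> 'a mat" where
    "g = (\<lambda>(h,B,Y). four_block_mat (companion (Suc j) h) B (0\<^sub>m l (Suc j)) Y)"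
  \<comment> \<open>\<open>p X\<close> reads \<open>h\<close> back from column \<open>j\<close>, the
    last column of the companion block, which holds the negated lower coefficients.\<close>
  define p :: "'a mat \<Rightarrow> 'a poly" where
    "p X = monom 1 (Suc j) - (\<Sum>r\<le>j. monom (X $$ (r,j)) r)" for X
  define g' :: "'a mat \<Rightarrow> 'a poly \<times> 'a mat \<times> 'a mat" where
    "g' X = (p X, mat (Suc j) l (\<lambda>(r,c). X $$ (r, Suc j + c)), mat l l (\<lambda>(r,c). X $$ (Suc j + r, Suc j + c)))" for X
  have coeff_p: "coeff (p X) r = (if r = Suc j then 1 else if r \<le> j then - X $$ (r,j) else 0)" for X r
    unfolding p_def by (auto simp: coeff_sum)
  have deg_p: "degree (p X) = Suc j" for X
    by (rule antisym[OF degree_le le_degree]) (auto simp: coeff_p)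
  have monic_p: "lead_coeff (p X) = 1" for X by (simp add: deg_p coeff_p)
  have g: "g (h,B,Y) \<in> carrier_mat k k" "char_poly (g (h,B,Y)) = h * char_poly Y"
    if "lead_coeff h = 1" "degree h = Suc j" "B \<in> carrier_mat (Suc j) l" "Y \<in> carrier_mat l l" for h B Y
    using four_block_carrier_mat[OF companion_carrier that(4), of "Suc j" h]
      char_poly_block_triangular[OF companion_carrier that(3,4), of h] char_poly_companion[OF that(1,2)]
    unfolding g_def k by simp_all
  have TX: "X \<in> carrier_mat k k" "char_poly X = f"
     "\<And>r i. r < k \<Longrightarrow> i < j \<Longrightarrow> X $$ (r,i) = (if r = Suc i then 1 else 0)"
     "\<And>i. j < i \<Longrightarrow> i < k \<Longrightarrow> X $$ (i,j) = 0" if "X \<in> T" for X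
  proof -
    show X: "X \<in> carrier_mat k k" "char_poly X = f"
      using that by (auto simp: T_def shift_fibre_def char_fibre_def)
    show "X $$ (r,i) = (if r = Suc i then 1 else 0)" if "r < k" "i < j" for r i
    proof -
      have "col X i = unit_vec k (Suc i)" using \<open>X \<in> T\<close> that by (auto simp: T_def shift_fibre_def)
      from arg_cong[OF this, of "\<lambda>v. v $ r"] show ?thesis using that X(1) k by simp
    qed
    show "\<And>i. j < i \<Longrightarrow> i < k \<Longrightarrow> X $$ (i,j) = 0" using that by (auto simp: T_def)
  qed
  have gg': "g (g' X) = X" if "X \<in> T" for X
  proof (rule eq_matI)
    show "g (g' X) $$ (r,c) = X $$ (r,c)" if "r < dim_row X" "c < dim_col X" for r c
    proof -
      have rc: "r < k" "c < k" using that TX(1)[OF \<open>X \<in> T\<close>] by auto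
      consider "c < j" | "c = j" | "j < c" by linarith
      then show ?thesis
        by cases (use rc k TX(3,4)[OF \<open>X \<in> T\<close>] in \<open>auto simp: g_def g'_def companion_def coeff_p less_Suc_eq\<close>)
    qed
  qed (use TX(1)[OF that] k in \<open>auto simp: g_def g'_def companion_def\<close>)
  have "bij_betw g S T"
  proof (rule bij_betw_byWitness[where f' = g'])
    show "\<forall>x\<in>S. g' (g x) = x"
    proof
      fix x assume "x \<in> S"
      then obtain h B Y where x: "x = (h,B,Y)" and h: "lead_coeff h = 1" "degree h = Suc j"
        and B: "B \<in> carrier_mat (Suc j) l" and Y: "Y \<in> carrier_mat l l"
        by (auto simp: S_def H_def monic_divisors_def char_fibre_def)
      have "p (g x) = h"
      proof (rule poly_eqI)
        fix r
        consider "r \<le> j" | "r = Suc j" | "Suc j < r" by linarith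
        then show "coeff (p (g x)) r = coeff h r"
          by cases (use h B Y in \<open>auto simp: coeff_p x g_def companion_def coeff_eq_0\<close>)
      qed
      moreover have "mat (Suc j) l (\<lambda>(r,c). g x $$ (r, Suc j + c)) = B"
        by (rule eq_matI) (use B Y in \<open>auto simp: x g_def companion_def\<close>)
      moreover have "mat l l (\<lambda>(r,c). g x $$ (Suc j + r, Suc j + c)) = Y"
        by (rule eq_matI) (use B Y in \<open>auto simp: x g_def companion_def\<close>)
      ultimately show "g' (g x) = x" unfolding g'_def x by simp
    qed
    show "\<forall>X\<in>T. g (g' X) = X" using gg' by simp
    show "g ` S \<subseteq> T"
    proof
      fix X assume "X \<in> g ` S"
      then obtain h B Y where X: "X = g (h,B,Y)" and h: "lead_coeff h = 1" "degree h = Suc j" "h dvd f"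
        and B: "B \<in> carrier_mat (Suc j) l" and Y: "Y \<in> carrier_mat l l" "char_poly Y = f div h"
        by (auto simp: S_def H_def monic_divisors_def char_fibre_def)
      have "col X i = unit_vec k (Suc i)" if "i < j" for i
        by (rule eq_vecI) (use that X k Y B in \<open>auto simp: g_def companion_def\<close>)
      moreover have "X $$ (i,j) = 0" if "j < i" "i < k" for i
        using that X k Y B by (auto simp: g_def companion_def)
      ultimately show "X \<in> T"
        using g[OF h(1,2) B Y(1)] h(3) Y(2) unfolding X T_def shift_fibre_def char_fibre_def by auto
    qed
    show "g' ` T \<subseteq> S"
    proof
      fix x assume "x \<in> g' ` T"
      then obtain X where X: "X \<in> T" and x: "x = g' X" by auto
      define B where "B = mat (Suc j) l (\<lambda>(r,c). X $$ (r, Suc j + c))"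
      define Y where "Y = mat l l (\<lambda>(r,c). X $$ (Suc j + r, Suc j + c))"
      have BY: "B \<in> carrier_mat (Suc j) l" "Y \<in> carrier_mat l l" unfolding B_def Y_def by auto
      have x': "x = (p X, B, Y)" unfolding x g'_def B_def Y_def ..
      have f: "f = p X * char_poly Y"
        using g(2)[OF monic_p[of X] deg_p[of X] BY] gg'[OF X] TX(2)[OF X] unfolding x[symmetric] x' by simp
      moreover have "p X \<noteq> 0" using deg_p[of X] by auto
      ultimately have "f div p X = char_poly Y" "p X dvd f" by auto
      then show "x \<in> S" unfolding x' S_def H_def monic_divisors_def char_fibre_def
        using BY monic_p deg_p by auto
    qed
  qed
  then have "card T = card S" by (simp add: bij_betw_same_card)
  also have "finite H"
    by (rule finite_subset[OF _ finite_poly_degree_le[of "Suc j"]]) (auto simp: H_def)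
  then have "card S = (\<Sum>h\<in>H. card (UNIV :: 'a set) ^ (Suc j * l) * card (char_fibre l (f div h)))"
    unfolding S_def
    by (simp add: card_SigmaI finite_carrier_mat finite_char_fibre card_cartesian_product card_carrier_mat)
  finally show ?thesis unfolding T_def H_def l_def .
qed

lemma card_vec_supported_below:
  assumes "m \<le> k"
  shows "card {w \<in> carrier_vec k :: 'a::{zero,finite} vec set. \<forall>i. m \<le> i \<and> i < k \<longrightarrow> w $ i = 0} = card (UNIV :: 'a set) ^ m"
proof -
  have "bij_betw (\<lambda>v. vec k (\<lambda>i. if i < m then v $ i else 0)) (carrier_vec m)
    {w \<in> carrier_vec k :: 'a vec set. \<forall>i. m \<le> i \<and> i < k \<longrightarrow> w $ i = 0}"
    by (rule bij_betw_byWitness[where f' = "\<lambda>w. vec m (\<lambda>i. w $ i)"])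
      (use assms in \<open>auto intro!: eq_vecI\<close>)
  from bij_betw_same_card[OF this] show ?thesis by (simp add: card_carrier_vec)
qed

text \<open>Column \<open>j\<close> either stays in the span \<open>W\<close> of the first
  \<open>Suc j\<close> unit vectors, which ends the Krylov sequence, or is one of the remaining
  \<open>q ^ k - q ^ Suc j\<close> vectors, which all contribute equally.\<close>

lemma card_shift_fibre:
  fixes f :: "'a::{field,finite} poly"
  assumes jk: "Suc j \<le> k"
  shows "card (shift_fibre j k f) =
    (\<Sum>h\<in>{h \<in> monic_divisors f. degree h = Suc j}.
      card (UNIV :: 'a set) ^ (Suc j * (k - Suc j)) * card (char_fibre (k - Suc j) (f div h))) +
    (card (UNIV :: 'a set) ^ k - card (UNIV :: 'a set) ^ Suc j) * card (shift_fibre (Suc j) k f)"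
proof -
  define V where "V = (carrier_vec k :: 'a vec set)"
  define W where "W = {w \<in> V. \<forall>i. Suc j \<le> i \<and> i < k \<longrightarrow> w $ i = 0}"
  define S where "S = shift_fibre j k f"
  have finS: "finite S" unfolding S_def by (rule finite_shift_fibre)
  have finV: "finite V" unfolding V_def by (rule finite_carrier_vec)
  have WV: "W \<subseteq> V" unfolding W_def by auto
  have S: "X \<in> carrier_mat k k" if "X \<in> S" for X
    using that by (auto simp: S_def shift_fibre_def char_fibre_def)
  have cols: "col X j \<in> V" if "X \<in> S" for X
    using S[OF that] unfolding V_def by (auto intro: carrier_vecI)
  have "{X \<in> S. col X j \<in> W} = {X \<in> S. \<forall>i. j < i \<and> i < k \<longrightarrow> X $$ (i,j) = 0}"
    using cols S jk by (fastforce simp: W_def Suc_le_eq)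
  then have W: "card {X \<in> S. col X j \<in> W} = (\<Sum>h\<in>{h \<in> monic_divisors f. degree h = Suc j}.
      card (UNIV :: 'a set) ^ (Suc j * (k - Suc j)) * card (char_fibre (k - Suc j) (f div h)))"
    using card_shift_fibre_col_staying[OF jk] unfolding S_def by simp
  have "card S = card {X \<in> S. col X j \<in> W} + card {X \<in> S. col X j \<notin> W}"
  proof -
    have "S = {X \<in> S. col X j \<in> W} \<union> {X \<in> S. col X j \<notin> W}" by auto
    then have "card S = card ({X \<in> S. col X j \<in> W} \<union> {X \<in> S. col X j \<notin> W})" by simp
    also have "\<dots> = card {X \<in> S. col X j \<in> W} + card {X \<in> S. col X j \<notin> W}"
      by (rule card_Un_disjoint) (use finS in auto)
    finally show ?thesis .
  qed
  moreover have "card {X \<in> S. col X j \<notin> W} = (card V - card W) * card (shift_fibre (Suc j) k f)"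
  proof -
    have "card {X \<in> S. col X j \<notin> W} = (\<Sum>w\<in>V - W. card {X \<in> {X \<in> S. col X j \<notin> W}. col X j = w})"
      by (rule card_eq_sum_fibres) (use finS finV cols in auto)
    also have "\<dots> = (\<Sum>w\<in>V - W. card (shift_fibre (Suc j) k f))"
    proof (rule sum.cong[OF refl])
      fix w assume w: "w \<in> V - W"
      then obtain s where s: "Suc j \<le> s" "s < k" "w $ s \<noteq> 0" unfolding W_def by auto
      have "{X \<in> {X \<in> S. col X j \<notin> W}. col X j = w} = {X \<in> shift_fibre j k f. col X j = w}"
        using w unfolding S_def by auto
      then show "card {X \<in> {X \<in> S. col X j \<notin> W}. col X j = w} = card (shift_fibre (Suc j) k f)"
        using card_shift_fibre_col_leaving[OF _ s(2,1,3), of f] w unfolding V_def by simp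
    qed
    also have "\<dots> = (card V - card W) * card (shift_fibre (Suc j) k f)"
      using finite_subset[OF WV finV] WV by (simp add: card_Diff_subset)
    finally show ?thesis .
  qed
  ultimately show ?thesis
    using W card_vec_supported_below[OF jk, where 'a='a]
    unfolding S_def[symmetric] by (simp add: V_def W_def card_carrier_vec)
qed

subsection \<open>Monic divisors and the weight of a polynomial\<close>

lemma F_fun_0 [simp]: "F_fun q 0 = 1"
  unfolding F_fun_def by simp

lemma F_fun_Suc: "F_fun q (Suc r) = F_fun q r * (1 - 1 / q ^ Suc r)"
  unfolding F_fun_def by (simp add: power_int_minus divide_inverse power_int_add del: power_Suc flip: power_int_of_nat)

lemma F_fun_pos:
  assumes "q > 1"
  shows "F_fun q r > 0"
proof (induction r)
  case (Suc r)
  have "q ^ Suc r > 1" using assms by (intro one_less_power) auto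
  then show ?case using Suc by (simp add: F_fun_Suc del: power_Suc)
qed simp

text \<open>The sum telescopes, since the term for \<open>Suc e\<close> is the difference of the
  reciprocals of \<open>F_fun q (Suc e)\<close> and \<open>F_fun q e\<close>. It is the divisor sum
  identity for the powers of a single prime.\<close>

lemma sum_inverse_F_fun:
  assumes "q > 1"
  shows "(\<Sum>i\<le>e. 1 / (q ^ i * F_fun q i)) = 1 / F_fun q e"
proof (induction e)
  case (Suc e)
  define u where "u = q ^ Suc e"
  have u: "u > 1" unfolding u_def using assms by (intro one_less_power) auto
  have F: "F_fun q e \<noteq> 0" using F_fun_pos[OF assms, of e] by simp
  have "(\<Sum>i\<le>Suc e. 1 / (q ^ i * F_fun q i)) = 1 / F_fun q e + 1 / (u * (F_fun q e * (1 - 1 / u)))"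
    by (simp add: Suc F_fun_Suc u_def)
  also have "\<dots> = 1 / (F_fun q e * (1 - 1 / u))"
    using u F by (simp add: field_simps)
  finally show ?case by (simp add: F_fun_Suc u_def)
qed simp

text \<open>Elements with \<open>prime\<close> are normalized by definition, and over a field a
  normalized nonzero polynomial is monic. Hence \<open>prime_factors\<close> consists of the
  distinct monic irreducible factors.\<close>

lemma lead_coeff_prime_poly:
  fixes p :: "'a::field_gcd poly"
  assumes "prime p"
  shows "lead_coeff p = 1"
proof -
  have p: "p \<noteq> 0" "normalize p = p" using assms by (auto simp: prime_def)
  have "lead_coeff p = coeff (normalize p) (degree p)" using p by simp
  also have "\<dots> = lead_coeff p div unit_factor (lead_coeff p)"
    by (simp only: normalize_poly_eq_map_poly) (simp add: coeff_map_poly)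
  also have "\<dots> = normalize (lead_coeff p)" by (rule div_unit_factor)
  also have "\<dots> = 1" using p by (intro is_unit_normalize) (simp add: dvd_field_iff)
  finally show ?thesis .
qed

text \<open>Splitting the full power of \<open>p\<close> off a divisor leaves a factor coprime to
  \<open>p\<close>, which must divide \<open>f\<close>; the exponent is recovered as the
  multiplicity of \<open>p\<close>.\<close>

lemma monic_divisors_prime_power_mult:
  fixes p f :: "'a::field_gcd poly"
  assumes p: "prime p" and f: "\<not> p dvd f" "lead_coeff f = 1"
  shows "monic_divisors (p ^ e * f) = (\<lambda>(i,g). p ^ i * g) ` ({..e} \<times> monic_divisors f)"
    and "inj_on (\<lambda>(i,g). p ^ i * g) ({..e} \<times> monic_divisors f)"
proof -
  have p1: "lead_coeff p = 1" and p0: "p \<noteq> 0" and pu: "\<not> is_unit p"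
    using lead_coeff_prime_poly[OF p] not_prime_unit[of p] p by auto
  have f0: "f \<noteq> 0" using f by auto
  show "monic_divisors (p ^ e * f) = (\<lambda>(i,g). p ^ i * g) ` ({..e} \<times> monic_divisors f)"
  proof (intro equalityI subsetI)
    fix g assume "g \<in> monic_divisors (p ^ e * f)"
    then have g: "lead_coeff g = 1" "g dvd p ^ e * f" unfolding monic_divisors_def by auto
    have g0: "g \<noteq> 0" using g by auto
    define i where "i = multiplicity p g"
    obtain g' where g': "g = p ^ i * g'" "\<not> p dvd g'"
      using multiplicity_decompose'[OF g0 pu] unfolding i_def by metis
    have "i \<le> multiplicity p (p ^ e * f)"
      unfolding i_def using g p0 f0 by (intro dvd_imp_multiplicity_le) auto
    also have "\<dots> = e"
      using p p0 f0 f by (simp add: prime_elem_multiplicity_mult_distrib not_dvd_imp_multiplicity_0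
        multiplicity_same_power pu)
    finally have ie: "i \<le> e" .
    have "coprime g' (p ^ e)"
      using prime_imp_coprime[OF p g'(2)] by (simp add: coprime_commute)
    moreover have "g' dvd p ^ e * f" using g(2) g'(1) by (metis dvd_mult_right)
    ultimately have "g' dvd f" by (simp add: coprime_dvd_mult_right_iff)
    moreover have "lead_coeff g' = 1" using g(1) p1 unfolding g'(1) by (simp add: lead_coeff_mult lead_coeff_power)
    ultimately show "g \<in> (\<lambda>(i,g). p ^ i * g) ` ({..e} \<times> monic_divisors f)"
      using ie g'(1) unfolding monic_divisors_def by (intro image_eqI[of _ _ "(i,g')"]) auto
  next
    fix h assume "h \<in> (\<lambda>(i,g). p ^ i * g) ` ({..e} \<times> monic_divisors f)"
    then obtain i g where "i \<le> e" "g \<in> monic_divisors f" "h = p ^ i * g" by auto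
    then show "h \<in> monic_divisors (p ^ e * f)"
      using p1 unfolding monic_divisors_def
      by (auto simp: lead_coeff_mult lead_coeff_power intro!: mult_dvd_mono le_imp_power_dvd)
  qed
  have mult: "multiplicity p (p ^ i * g) = i" if "g \<in> monic_divisors f" for i g
  proof -
    have "g dvd f" using that unfolding monic_divisors_def by auto
    then have "\<not> p dvd g" "g \<noteq> 0" using f(1) f0 dvd_trans by auto
    then show ?thesis
      using p p0 by (simp add: prime_elem_multiplicity_mult_distrib not_dvd_imp_multiplicity_0
        multiplicity_same_power pu)
  qed
  show "inj_on (\<lambda>(i,g). p ^ i * g) ({..e} \<times> monic_divisors f)"
  proof (rule inj_onI, clarify)
    fix i g i' g' assume g: "g \<in> monic_divisors f" "g' \<in> monic_divisors f" and eq: "p ^ i * g = p ^ i' * g'"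
    then have "i = i'" using mult by metis
    then show "i = i' \<and> g = g'" using eq p0 by simp
  qed
qed

text \<open>The number of matrices with characteristic polynomial \<open>f\<close> divided by the order of the
  general linear group of degree \<open>deg f\<close>.\<close>

definition cyclic_weight :: "'a::field_gcd poly \<Rightarrow> real" where
  "cyclic_weight f = 1 / (real (card (UNIV :: 'a set)) ^ degree f *
    (\<Prod>p\<in>prime_factors f. F_fun (real (card (UNIV :: 'a set)) ^ degree p) (multiplicity p f)))"

lemma cyclic_weight_1 [simp]: "cyclic_weight 1 = 1"
  unfolding cyclic_weight_def by simp

lemma card_field_gt_1: "1 < real (card (UNIV :: 'a::{field,finite} set))"
proof -
  have "card {0, 1 :: 'a} \<le> card (UNIV :: 'a set)" by (rule card_mono) auto
  then show ?thesis by simp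
qed

text \<open>The weight is multiplicative over coprime factors because multiplicities of other primes
  are not affected by \<open>p ^ i\<close>.\<close>

lemma cyclic_weight_prime_power_mult:
  fixes p g :: "'a::{field_gcd,finite} poly"
  assumes p: "prime p" and g: "\<not> p dvd g"
  defines "Q \<equiv> real (card (UNIV :: 'a set)) ^ degree p"
  shows "cyclic_weight (p ^ i * g) = 1 / (Q ^ i * F_fun Q i) * cyclic_weight g"
proof -
  define q where "q = real (card (UNIV :: 'a set))"
  have p0: "p \<noteq> 0" and pu: "\<not> is_unit p" using p not_prime_unit[of p] by (auto simp del: is_unit_poly_iff)
  have g0: "g \<noteq> 0" using g by auto
  let ?h = "p ^ i * g"
  have h0: "?h \<noteq> 0" using p0 g0 by simp
  \<comment> \<open>For \<open>i = 0\<close> the prime \<open>p\<close> does not divide the product.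
    Inserting it regardless is harmless, as \<open>F_fun\<close> is 1 at multiplicity 0.\<close>
  let ?A = "insert p (prime_factors g)"
  have sub: "prime_factors ?h \<subseteq> ?A"
    using p p0 g0 by (auto simp: prime_factors_product prime_factorization_prime_power split: if_splits)
  have mp: "multiplicity p ?h = i"
    using p p0 g0 g by (simp add: prime_elem_multiplicity_mult_distrib not_dvd_imp_multiplicity_0
        multiplicity_same_power pu)
  have mr: "multiplicity r ?h = multiplicity r g" if "r \<in> prime_factors g" for r
  proof -
    have r: "prime r" "r \<noteq> p" using that g by auto
    then have "multiplicity r (p ^ i) = 0" using p by (simp add: multiplicity_distinct_prime_power)
    then show ?thesis using r p0 g0 by (simp add: prime_elem_multiplicity_mult_distrib)
  qed
  have pg: "p \<notin> prime_factors g" using g by auto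
  have "(\<Prod>r\<in>prime_factors ?h. F_fun (q ^ degree r) (multiplicity r ?h)) =
    (\<Prod>r\<in>?A. F_fun (q ^ degree r) (multiplicity r ?h))"
  proof (rule prod.mono_neutral_left[OF _ sub])
    show "\<forall>r\<in>?A - prime_factors ?h. F_fun (q ^ degree r) (multiplicity r ?h) = 1"
    proof
      fix r assume r: "r \<in> ?A - prime_factors ?h"
      then have "prime r" using p by auto
      then have "multiplicity r ?h = 0"
        using r h0 by (auto simp: prime_factors_multiplicity)
      then show "F_fun (q ^ degree r) (multiplicity r ?h) = 1" by simp
    qed
  qed simp
  also have "\<dots> = F_fun Q i * (\<Prod>r\<in>prime_factors g. F_fun (q ^ degree r) (multiplicity r g))"
    using pg by (simp add: mp mr Q_def q_def)
  finally have prod: "(\<Prod>r\<in>prime_factors ?h. F_fun (q ^ degree r) (multiplicity r ?h)) =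
    F_fun Q i * (\<Prod>r\<in>prime_factors g. F_fun (q ^ degree r) (multiplicity r g))" .
  have "q ^ degree ?h = Q ^ i * q ^ degree g"
    using p0 g0 by (simp add: degree_mult_eq degree_power_eq power_add power_mult Q_def q_def mult.commute flip: power_mult)
  then show ?thesis using prod unfolding cyclic_weight_def q_def[symmetric] by simp
qed

text \<open>Both sides are multiplicative, so induction on the number of distinct primes strips off
  one full prime power at a time and reduces the claim to the telescoping sum with
  \<open>Q = q ^ degree p\<close>.\<close>

lemma sum_cyclic_weight_monic_divisors:
  fixes f :: "'a::{field_gcd,finite} poly"
  assumes "lead_coeff f = 1"
  shows "(\<Sum>g\<in>monic_divisors f. cyclic_weight g) = real (card (UNIV :: 'a set)) ^ degree f * cyclic_weight f"
  using assms
proof (induction "card (prime_factors f)" arbitrary: f)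
  case 0
  have "is_unit f" using 0 by (auto simp: prime_factorization_empty_iff)
  then have "f = 1" using 0 normalize_monic_poly[of f] is_unit_normalize[of f] by simp
  moreover have "monic_divisors (1::'a poly) = {1}"
  proof -
    have "g = 1" if "lead_coeff g = 1" "g dvd 1" for g :: "'a poly"
      using that normalize_monic_poly[of g] is_unit_normalize[of g] by simp
    then show ?thesis unfolding monic_divisors_def by auto
  qed
  ultimately show ?case by simp
next
  case (Suc c)
  have f0: "f \<noteq> 0" using Suc.prems by auto
  obtain p where pf: "p \<in> prime_factors f" using Suc.hyps(2) by (metis card.empty ex_in_conv nat.distinct(1))
  then have p: "prime p" by auto
  have p0: "p \<noteq> 0" and pu: "\<not> is_unit p" using p not_prime_unit[of p] by (auto simp del: is_unit_poly_iff)
  define e where "e = multiplicity p f"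
  obtain f' where f: "f = p ^ e * f'" and pf': "\<not> p dvd f'"
    using multiplicity_decompose'[OF f0 pu] unfolding e_def by metis
  have e0: "e > 0" using pf f0 p unfolding e_def by (simp add: prime_factors_multiplicity)
  have f'0: "f' \<noteq> 0" using f f0 by auto
  have lf': "lead_coeff f' = 1"
    using Suc.prems lead_coeff_prime_poly[OF p] unfolding f by (simp add: lead_coeff_mult lead_coeff_power)
  have "prime_factors f = insert p (prime_factors f')"
    using p p0 f'0 e0 unfolding f by (simp add: prime_factors_product prime_factorization_prime_power)
  moreover have "p \<notin> prime_factors f'" using pf' by auto
  ultimately have "c = card (prime_factors f')" using Suc.hyps(2) by simp
  note IH = Suc.hyps(1)[OF this lf']
  define q where "q = real (card (UNIV :: 'a set))"
  define Q where "Q = q ^ degree p"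
  have "degree p > 0" using p pu p0 by (metis is_unit_iff_degree neq0_conv)
  then have Q: "Q > 1" unfolding Q_def q_def using card_field_gt_1 by (intro one_less_power)
  have FQ: "F_fun Q e \<noteq> 0" using F_fun_pos[OF Q, of e] by simp
  have ng: "\<not> p dvd g" if "g \<in> monic_divisors f'" for g
    using that pf' dvd_trans unfolding monic_divisors_def by blast
  have "(\<Sum>g\<in>monic_divisors f. cyclic_weight g) =
    (\<Sum>(i,g)\<in>{..e} \<times> monic_divisors f'. cyclic_weight (p ^ i * g))"
    unfolding f monic_divisors_prime_power_mult(1)[OF p pf' lf']
    by (subst sum.reindex[OF monic_divisors_prime_power_mult(2)[OF p pf' lf']]) (simp add: case_prod_unfold)
  also have "\<dots> = (\<Sum>i\<le>e. \<Sum>g\<in>monic_divisors f'. 1 / (Q ^ i * F_fun Q i) * cyclic_weight g)"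
    unfolding sum.cartesian_product[symmetric]
    by (intro sum.cong refl) (simp add: cyclic_weight_prime_power_mult[OF p ng] Q_def q_def)
  also have "\<dots> = (\<Sum>i\<le>e. 1 / (Q ^ i * F_fun Q i)) * (\<Sum>g\<in>monic_divisors f'. cyclic_weight g)"
    by (simp add: sum_product)
  also have "\<dots> = 1 / F_fun Q e * (q ^ degree f' * cyclic_weight f')"
    unfolding sum_inverse_F_fun[OF Q] IH q_def ..
  also have "\<dots> = q ^ degree f * cyclic_weight f"
  proof -
    have "q ^ degree f = Q ^ e * q ^ degree f'"
      unfolding f using p0 f'0
      by (simp add: degree_mult_eq degree_power_eq power_add Q_def mult.commute flip: power_mult)
    then show ?thesis
      unfolding f using cyclic_weight_prime_power_mult[OF p pf', of e] Q FQ
      by (simp add: Q_def q_def)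
  qed
  finally show ?case unfolding q_def .
qed

subsection \<open>Counting the fibres\<close>

text \<open>The right side is the order of the general linear group, counting ordered bases.
  Choosing the first \<open>m\<close> vectors first leaves \<open>q ^ (m * (k - m))\<close> lifts of
  each ordered basis of the quotient.\<close>

lemma prod_power_diff_split:
  fixes q :: real
  assumes "m \<le> k"
  shows "(\<Prod>i<m. q ^ k - q ^ i) * q ^ (m * (k - m)) * (\<Prod>i<k - m. q ^ (k - m) - q ^ i) = (\<Prod>i<k. q ^ k - q ^ i)"
proof -
  have "(\<Prod>i<k. q ^ k - q ^ i) = (\<Prod>i\<in>{..<m} \<union> {m..<k}. q ^ k - q ^ i)"
    using assms by (intro prod.cong) auto
  also have "\<dots> = (\<Prod>i<m. q ^ k - q ^ i) * (\<Prod>i=m..<k. q ^ k - q ^ i)"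
    by (rule prod.union_disjoint) auto
  also have "(\<Prod>i=m..<k. q ^ k - q ^ i) = (\<Prod>i<k - m. q ^ k - q ^ (m + i))"
    using assms prod.shift_bounds_nat_ivl[of "\<lambda>i. q ^ k - q ^ i" 0 m "k - m"]
    by (simp add: atLeast0LessThan add.commute)
  also have "\<dots> = (\<Prod>i<k - m. q ^ m * (q ^ (k - m) - q ^ i))"
    using assms by (intro prod.cong) (auto simp: right_diff_distrib simp flip: power_add)
  also have "\<dots> = q ^ (m * (k - m)) * (\<Prod>i<k - m. q ^ (k - m) - q ^ i)"
    by (simp add: prod.distrib power_mult)
  finally show ?thesis by simp
qed

text \<open>Unrolling the Krylov sequence of a nonzero vector: \<open>m\<close> is the dimension of the cyclic
  subspace that it generates and \<open>h\<close> its minimal polynomial.\<close>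

lemma card_char_fibre_recursion:
  fixes f :: "'a::{field,finite} poly"
  defines "q \<equiv> real (card (UNIV :: 'a set))"
  shows "(q ^ k - 1) * card (char_fibre k f) = (\<Sum>m=1..k. (\<Prod>i<m. q ^ k - q ^ i) * q ^ (m * (k - m)) *
    (\<Sum>h\<in>{h \<in> monic_divisors f. degree h = m}. real (card (char_fibre (k - m) (f div h)))))"
proof -
  define t where "t m = (\<Prod>i<m. q ^ k - q ^ i) * q ^ (m * (k - m)) *
    (\<Sum>h\<in>{h \<in> monic_divisors f. degree h = m}. real (card (char_fibre (k - m) (f div h))))" for m
  have q1: "card (UNIV :: 'a set) \<ge> 1" using card_field_gt_1[where 'a='a] by simp
  have step: "real (card (shift_fibre j k f)) = q ^ (Suc j * (k - Suc j)) *
      (\<Sum>h\<in>{h \<in> monic_divisors f. degree h = Suc j}. real (card (char_fibre (k - Suc j) (f div h)))) +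
      (q ^ k - q ^ Suc j) * card (shift_fibre (Suc j) k f)" if "Suc j \<le> k" for j
    unfolding card_shift_fibre[OF that] q_def
    using power_increasing[OF that q1] by (simp add: of_nat_diff sum_distrib_left del: power_Suc mult_Suc)
  \<comment> \<open>After \<open>j\<close> steps a remainder is left. At \<open>j = 0\<close> it is
    everything; at \<open>j = k\<close> it vanishes because its product contains
    \<open>q ^ k - q ^ k\<close>.\<close>
  have "(q ^ k - 1) * card (char_fibre k f) =
    (\<Sum>m=1..j. t m) + (\<Prod>i<Suc j. q ^ k - q ^ i) * card (shift_fibre j k f)" if "j \<le> k" for j
    using that
  proof (induction j)
    case 0
    show ?case by (simp add: shift_fibre_def)
  next
    case (Suc j)
    have "(\<Prod>i<Suc j. q ^ k - q ^ i) * card (shift_fibre j k f) =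
      t (Suc j) + (\<Prod>i<Suc j. q ^ k - q ^ i) * (q ^ k - q ^ Suc j) * card (shift_fibre (Suc j) k f)"
      unfolding step[OF Suc.prems] t_def by (simp only: distrib_left mult.assoc)
    then show ?case using Suc by (simp del: power_Suc prod.lessThan_Suc add: prod.lessThan_Suc[of _ "Suc j"])
  qed
  from this[of k] show ?thesis by (simp add: t_def)
qed

text \<open>By induction each term of the recursion is the order \<open>G\<close> of the general
  linear group times the weight of \<open>f div h\<close> with \<open>h \<noteq> 1\<close>. The
  divisor sum identity evaluates the total to \<open>G * (q ^ k - 1) * cyclic_weight f\<close>, and
  \<open>q ^ k - 1\<close> cancels.\<close>

lemma card_char_fibre:
  fixes f :: "'a::{field_gcd,finite} poly"
  assumes "lead_coeff f = 1" and "degree f = k"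
  defines "q \<equiv> real (card (UNIV :: 'a set))"
  shows "real (card (char_fibre k f)) = (\<Prod>i<k. q ^ k - q ^ i) * cyclic_weight f"
  using assms(1,2)
proof (induction k arbitrary: f rule: less_induct)
  case (less k)
  have f0: "f \<noteq> 0" using less.prems by auto
  show ?case
  proof (cases "k = 0")
    case True
    then obtain c where "f = [:c:]" using less.prems degree_eq_zeroE by metis
    then have f1: "f = 1" using less.prems by (simp add: one_pCons)
    have "char_fibre 0 (1 :: 'a poly) = carrier_mat 0 0"
      unfolding char_fibre_def char_poly_def
      by (auto intro!: det_dim_zero char_poly_matrix_closed)
    then show ?thesis by (simp add: True f1 card_carrier_mat)
  next
    case False
    define G where "G = (\<Prod>i<k. q ^ k - q ^ i)"
    define H where "H m = {h \<in> monic_divisors f. degree h = m}" for m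
    have fin: "finite (monic_divisors f)"
      by (rule finite_subset[OF _ finite_poly_degree_le[of "degree f"]])
        (auto simp: monic_divisors_def dvd_imp_degree_le[OF _ f0])
    have div: "lead_coeff (f div h) = 1" "f = h * (f div h)" "degree (f div h) = k - degree h" "degree h \<le> k"
      if "h \<in> monic_divisors f" for h
    proof -
      show f: "f = h * (f div h)" using that by (simp add: monic_divisors_def)
      have h1: "lead_coeff h = 1" using that by (simp add: monic_divisors_def)
      have nz: "h \<noteq> 0" "f div h \<noteq> 0" using f f0 by auto
      have "lead_coeff f = lead_coeff h * lead_coeff (f div h)"
        using arg_cong[OF f, of lead_coeff] by (simp only: lead_coeff_mult)
      then show "lead_coeff (f div h) = 1" using h1 less.prems by simp
      have "degree f = degree h + degree (f div h)"
        using arg_cong[OF f, of degree] by (simp only: degree_mult_eq[OF nz])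
      then show "degree (f div h) = k - degree h" "degree h \<le> k" using less.prems by auto
    qed
    have "(q ^ k - 1) * card (char_fibre k f) = (\<Sum>m=1..k. (\<Prod>i<m. q ^ k - q ^ i) * q ^ (m * (k - m)) *
        (\<Sum>h\<in>H m. real (card (char_fibre (k - m) (f div h)))))"
      using card_char_fibre_recursion[of k f] unfolding q_def H_def by simp
    also have "\<dots> = (\<Sum>m=1..k. G * (\<Sum>h\<in>H m. cyclic_weight (f div h)))"
    proof (rule sum.cong[OF refl])
      fix m assume m: "m \<in> {1..k}"
      have "(\<Sum>h\<in>H m. real (card (char_fibre (k - m) (f div h)))) =
        (\<Sum>h\<in>H m. (\<Prod>i<k - m. q ^ (k - m) - q ^ i) * cyclic_weight (f div h))"
        by (rule sum.cong[OF refl], rule less.IH) (use m div in \<open>auto simp: H_def\<close>)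
      then show "(\<Prod>i<m. q ^ k - q ^ i) * q ^ (m * (k - m)) *
          (\<Sum>h\<in>H m. real (card (char_fibre (k - m) (f div h)))) = G * (\<Sum>h\<in>H m. cyclic_weight (f div h))"
        using prod_power_diff_split[of m k q] m
        by (simp add: G_def sum_distrib_left[symmetric] mult.assoc[symmetric])
    qed
    also have "\<dots> = G * (\<Sum>m=1..k. \<Sum>h\<in>H m. cyclic_weight (f div h))"
      by (simp add: sum_distrib_left)
    also have "(\<Sum>m=1..k. \<Sum>h\<in>H m. cyclic_weight (f div h)) =
      (\<Sum>h\<in>monic_divisors f - {1}. cyclic_weight (f div h))"
    proof -
      \<comment> \<open>A monic polynomial of degree 0 is 1, so starting at \<open>m = 1\<close>
        omits exactly the divisor 1.\<close>
      have "h = 1" if "degree h = 0" "lead_coeff h = 1" for h :: "'a poly"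
        using that by (metis degree_eq_zeroE lead_coeff_pCons(2) one_pCons)
      then have "monic_divisors f - {1} = (\<Union>m\<in>{1..k}. H m)"
        using div(4) by (fastforce simp: H_def monic_divisors_def Suc_le_eq)
      then show ?thesis
        using fin by (subst sum.UNION_disjoint[symmetric]) (auto simp: H_def)
    qed
    also have "\<dots> = (\<Sum>h\<in>monic_divisors f. cyclic_weight (f div h)) - cyclic_weight f"
      using fin by (subst sum_diff1) (auto simp: monic_divisors_def)
    also have "(\<Sum>h\<in>monic_divisors f. cyclic_weight (f div h)) = (\<Sum>g\<in>monic_divisors f. cyclic_weight g)"
    proof -
      \<comment> \<open>Passing to the complementary divisor is an involution on the monic divisors
        of \<open>f\<close>.\<close>
      have inv: "f div h \<in> monic_divisors f" "f div (f div h) = h" if "h \<in> monic_divisors f" for h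
      proof -
        have "f div h \<noteq> 0" using div(2)[OF that] f0 by auto
        then show "f div (f div h) = h" by (subst (1) div(2)[OF that]) simp
        show "f div h \<in> monic_divisors f"
          using div(1,2)[OF that] unfolding monic_divisors_def by (auto intro: dvdI[of _ _ h] simp: mult.commute)
      qed
      show ?thesis
        by (rule sum.reindex_bij_witness[of _ "\<lambda>g. f div g" "\<lambda>g. f div g"]) (auto simp: inv)
    qed
    also have "\<dots> = q ^ k * cyclic_weight f"
      using sum_cyclic_weight_monic_divisors[of f] less.prems unfolding q_def by simp
    finally have "(q ^ k - 1) * card (char_fibre k f) = (q ^ k - 1) * (G * cyclic_weight f)"
      by (simp add: algebra_simps)
    moreover have "q ^ k > 1" using False card_field_gt_1[where 'a='a] unfolding q_def by simp
    ultimately show ?thesis unfolding G_def by simp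
  qed
qed

section \<open>The order of the general linear group and q-binomial coefficients\<close>

lemma prod_power_diff_eq_F_fun:
  assumes "q > 0"
  shows "(\<Prod>i<d. q ^ d - q ^ i) = q ^ d\<^sup>2 * F_fun q d"
proof -
  have "(\<Prod>i<d. q ^ d - q ^ i) = (\<Prod>i=1..d. q ^ d - q ^ (d - i))"
    by (rule prod.reindex_bij_witness[of _ "\<lambda>i. d - i" "\<lambda>i. d - i"]) auto
  also have "\<dots> = (\<Prod>i=1..d. q ^ d * (1 - q powi (- int i)))"
  proof (rule prod.cong[OF refl])
    fix i assume "i \<in> {1..d}"
    then have "q ^ d = q ^ (d - i) * q ^ i" by (simp flip: power_add)
    then show "q ^ d - q ^ (d - i) = q ^ d * (1 - q powi (- int i))"
      using assms by (simp add: power_int_minus field_simps)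
  qed
  also have "\<dots> = q ^ d\<^sup>2 * F_fun q d"
    by (simp add: F_fun_def prod.distrib power2_eq_square power_mult)
  finally show ?thesis .
qed

text \<open>The denominators agree, and both numerators are the same product of \<open>d + 1\<close>
  factors, with the last or the first one split off. In this product form the identity holds for
  every \<open>d\<close>: beyond \<open>k\<close> both sides vanish through truncated
  subtraction.\<close>

lemma qbinom_Suc: "qbinom q (Suc k) d * (q ^ (Suc k - d) - 1) = (q ^ Suc k - 1) * qbinom q k d"
proof -
  have "(\<Prod>i<d. q ^ (Suc k - i) - 1) * (q ^ (Suc k - d) - 1) = (\<Prod>i<Suc d. q ^ (Suc k - i) - 1)" by simp
  also have "\<dots> = (q ^ Suc k - 1) * (\<Prod>i<d. q ^ (k - i) - 1)"
    by (subst prod.lessThan_Suc_shift) simp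
  finally show ?thesis unfolding qbinom_def prod_dividef by (simp add: mult.assoc[symmetric])
qed

lemma qbinom_eq_0: "k < d \<Longrightarrow> qbinom q k d = 0"
  unfolding qbinom_def by (rule prod_zero) (auto intro!: bexI[of _ k])

lemma qbinom_self:
  assumes "q > 1"
  shows "qbinom q d d = 1"
proof -
  have "(\<Prod>i<d. q ^ (d - i) - 1) = (\<Prod>i<d. q ^ (i + 1) - 1)"
    by (rule prod.reindex_bij_witness[of _ "\<lambda>i. d - Suc i" "\<lambda>i. d - Suc i"]) (auto simp: Suc_diff_Suc simp del: power_Suc)
  moreover have "q ^ (i + 1) - 1 \<noteq> 0" for i using one_less_power[OF assms, of "i + 1"] by simp
  ultimately show ?thesis unfolding qbinom_def prod_dividef by simp
qed

text \<open>Induction on \<open>n\<close> for all \<open>k\<close> at once, with the square and the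
  empty case as bases. The degree of \<open>f\<close> is not bounded by \<open>k\<close>, because
  the recursion lowers \<open>k\<close>; below the degree the q-binomial coefficient is 0.\<close>

lemma card_Phi_fibre:
  fixes f :: "'a::{field_gcd,finite} poly"
  assumes f: "lead_coeff f = 1" and kn: "k \<le> n"
  defines "q \<equiv> real (card (UNIV :: 'a set))" and "d \<equiv> degree f"
  shows "real (card (Phi_fibre n k f)) =
    qbinom q k d * card (char_fibre d f) * (\<Prod>i=d+1..k. q ^ n - q ^ i)"
  using kn
proof (induction n arbitrary: k)
  have q: "q > 1" unfolding q_def by (rule card_field_gt_1)
  have square: "real (card (Phi_fibre k k f)) =
    qbinom q k d * card (char_fibre d f) * (\<Prod>i=d+1..k. q ^ k - q ^ i)" for k
  proof -
    have eq: "Phi_fibre k k f = char_fibre k f"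
      unfolding Phi_fibre_def char_fibre_def using Phi_square by auto
    have "char_fibre k f = {}" if "k \<noteq> d"
      using that degree_monic_char_poly unfolding char_fibre_def d_def by auto
    \<comment> \<open>A square matrix has characteristic polynomial of degree \<open>k\<close>, so
      the fibre is empty for \<open>d < k\<close>; the formula agrees, its factor at
      \<open>i = k\<close> being 0.\<close>
    moreover have "(\<Prod>i=d+1..k. q ^ k - q ^ i) = 0" if "d < k"
      using that by (intro prod_zero) auto
    ultimately show ?thesis
      by (cases k d rule: linorder_cases) (use eq in \<open>simp_all add: qbinom_eq_0 qbinom_self[OF q]\<close>)
  qed
  {
    case 0
    then show ?case using square[of 0] by simp
  next
    case (Suc n)
    consider "k = Suc n" | "k = 0" "k \<le> n" | k' where "k = Suc k'" "k' < n"
      using Suc.prems by (cases k) (auto simp: le_Suc_eq)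
    then show ?case
    proof cases
      case 1
      then show ?thesis using square[of "Suc n"] by simp
    next
      case 2
      have "Phi_fibre (Suc n) 0 f = (if f = 1 then carrier_mat (Suc n) 0 else {})"
        unfolding Phi_fibre_def Phi_0 by auto
      moreover have "d > 0" if "f \<noteq> 1"
        using that f unfolding d_def by (metis degree_eq_zeroE gr0I lead_coeff_pCons(2) one_pCons)
      moreover have "card (char_fibre 0 (1 :: 'a poly)) = 1"
        using card_char_fibre[of "1 :: 'a poly" 0] by simp
      ultimately show ?thesis
        using 2 by (auto simp: card_carrier_mat qbinom_eq_0 d_def qbinom_self[OF q])
    next
      case 3
      define C where "C = real (card (char_fibre d f))"
      have "card (UNIV :: 'a set) ^ Suc k' \<ge> 1" using q unfolding q_def by simp
      then have rec: "real (card (Phi_fibre (Suc n) k f)) =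
        qbinom q k d * C * (\<Prod>i=d+1..k. q ^ n - q ^ i) +
        (q ^ k - 1) * (q ^ n * (qbinom q k' d * C * (\<Prod>i=d+1..k'. q ^ n - q ^ i)))"
        using Suc.IH[of k] Suc.IH[of k'] 3 unfolding card_Phi_fibre_Suc[OF 3(2)] 3(1) C_def
        by (simp add: of_nat_diff q_def del: power_Suc)
      consider "k < d" | "k = d" | "d < k" by linarith
      then have "qbinom q k d * (\<Prod>i=d+1..k. q ^ n - q ^ i) +
          (q ^ k - 1) * q ^ n * qbinom q k' d * (\<Prod>i=d+1..k'. q ^ n - q ^ i) =
          qbinom q k d * (\<Prod>i=d+1..k. q ^ Suc n - q ^ i)"
      proof cases
        case dk: 3
        define R where "R = (\<Prod>i=d+1..k'. q ^ n - q ^ i)"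
        have dk': "d \<le> k'" using dk 3 by simp
        have R: "(\<Prod>i=d+1..k. q ^ n - q ^ i) = R * (q ^ n - q ^ k)"
          using 3 dk by (simp add: R_def)
        have "(\<Prod>i=d+1..k. q ^ Suc n - q ^ i) = (\<Prod>i=d..k'. q ^ Suc n - q ^ Suc i)"
          unfolding 3(1) using prod.shift_bounds_cl_Suc_ivl[of "\<lambda>i. q ^ Suc n - q ^ i" d k'] by simp
        also have "\<dots> = (\<Prod>i=d..k'. q * (q ^ n - q ^ i))"
          by (simp add: right_diff_distrib)
        also have "\<dots> = q ^ (k - d) * (\<Prod>i=d..k'. q ^ n - q ^ i)"
          using 3 dk' by (simp add: prod.distrib Suc_diff_le)
        also have "(\<Prod>i=d..k'. q ^ n - q ^ i) = (q ^ n - q ^ d) * R"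
          unfolding R_def using dk' by (simp add: prod.atLeast_Suc_atMost)
        finally have L: "(\<Prod>i=d+1..k. q ^ Suc n - q ^ i) = q ^ (k - d) * ((q ^ n - q ^ d) * R)" .
        have "q ^ (k - d) * q ^ d = q ^ k" using dk by (simp flip: power_add)
        \<comment> \<open>This splits the new factor so that the first part reproduces the old
          product up to \<open>k\<close> and the second one carries the factor
          \<open>q ^ (k - d) - 1\<close> of the q-binomial recursion.\<close>
        then have T: "q ^ (k - d) * (q ^ n - q ^ d) = (q ^ n - q ^ k) + (q ^ (k - d) - 1) * q ^ n"
          by (simp add: algebra_simps)
        have B: "qbinom q k d * (q ^ (k - d) - 1) = (q ^ k - 1) * qbinom q k' d"
          unfolding 3(1) by (rule qbinom_Suc)
        have "qbinom q k d * (q ^ (k - d) * ((q ^ n - q ^ d) * R)) =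
          qbinom q k d * R * (q ^ (k - d) * (q ^ n - q ^ d))" by (simp only: mult_ac)
        also have "\<dots> = qbinom q k d * (R * (q ^ n - q ^ k)) +
          qbinom q k d * (q ^ (k - d) - 1) * q ^ n * R"
          unfolding T by (simp only: distrib_left mult_ac)
        finally show ?thesis unfolding L R R_def[symmetric] B by simp
      qed (use 3 in \<open>auto simp: qbinom_eq_0\<close>)
      then have "C * (qbinom q k d * (\<Prod>i=d+1..k. q ^ n - q ^ i) +
          (q ^ k - 1) * q ^ n * qbinom q k' d * (\<Prod>i=d+1..k'. q ^ n - q ^ i)) =
          C * (qbinom q k d * (\<Prod>i=d+1..k. q ^ Suc n - q ^ i))" by simp
      then show ?thesis unfolding rec C_def[symmetric] by (simp only: distrib_left mult_ac)
    qed
  }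
qed

theorem theorem5:
  fixes f :: "'a::{field_gcd, finite} poly" and n k :: nat
  defines "q \<equiv> card (UNIV :: 'a set)"
  assumes "1 \<le> k" and "k \<le> n"
    and "lead_coeff f = 1" and "degree f \<le> k"
  shows "real (card {A \<in> carrier_mat n k. Phi n k A = f}) =
           qbinom (real q) k (degree f)
           * (real q ^ (degree f ^ 2 - degree f) * F_fun (real q) (degree f)
              / (\<Prod>p\<in>prime_factors f. F_fun (real q ^ degree p) (multiplicity p f)))
           * (\<Prod>i=degree f + 1..k. real q ^ n - real q ^ i)"
proof -
  let ?d = "degree f"
  have q: "real q > 0" using card_field_gt_1[where 'a='a] unfolding q_def by simp
  \<comment> \<open>The subtraction in the exponent is therefore genuine: the order of the general
    linear group supplies \<open>q ^ (?d ^ 2)\<close>, and the weight divides by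
    \<open>q ^ ?d\<close>.\<close>
  have "?d \<le> ?d ^ 2" by (simp add: power2_nat_le_imp_le power2_eq_square)
  then have "real q ^ (?d ^ 2) = real q ^ (?d ^ 2 - ?d) * real q ^ ?d" by (simp flip: power_add)
  then have "real (card (char_fibre ?d f)) = real q ^ (?d ^ 2 - ?d) * F_fun (real q) ?d
      / (\<Prod>p\<in>prime_factors f. F_fun (real q ^ degree p) (multiplicity p f))"
    using q unfolding card_char_fibre[OF assms(4) refl] q_def[symmetric] prod_power_diff_eq_F_fun[OF q]
    by (simp add: cyclic_weight_def q_def)
  then show ?thesis
    using card_Phi_fibre[OF assms(4,3)] unfolding Phi_fibre_def q_def by simp
qed

end
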